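(* Let $(W,\mathfrak{C})$ be the Jordan algebra with cubic form associated with a complex simple Lie group $G$ not of type $A_\ell$ or $C_\ell$, and let $n=1+\dim W$. If $W\ne\mathcal{J}_3(\emptyset)$ and $W\neq\mathcal{JS}_1$, then the only solutions $T^c=T^c(X^e)$ of $$\mathfrak{C}_{ac[b}T^c{}_{,e]}=0,\qquad T^c{}_{,e}=\frac{\partial T^c}{\partial X^e},$$ are $T^c=\lambda X^c+\mu^c$, where $\lambda$ and $\mu^c$ are constants. In these cases, the solution of the second-order Monge equations $$Z_a=\tfrac32\mathfrak{C}_a(T^2),\qquad U_{ab}=3\mathfrak{C}_{ab}(T),\qquad T\in W,$$ is $$Z=\frac{\lambda^2}{2}\mathfrak{C}(X^3)+\frac{\lambda}{2}\mathfrak{C}_a(X^2)\mu^a+\mathfrak{C}_{ab}(X)\mu^a\mu^b+const,$$ $$U=\frac{\lambda}{2}\mathfrak{C}(X^3)+\frac12\mathfrak{C}_a(X^2)\mu^a+\nu_aX^a+const,$$ depending on $2n+1$ arbitrary constants.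
   Context: Everything is complex and local; the summation convention is used; indices satisfy $1\le a,b,c,e\le n-1$; square brackets denote skew-symmetrization over $b,e$. To $G$ is associated a vector space $W$ (a Jordan algebra) with cubic form $\mathfrak{C}\in S^3W^*$, as follows. $B_\ell$ ($\ell\ge3$): $W=\mathcal{JS}_{2\ell-5}$; $D_\ell$ ($\ell\ge5$): $W=\mathcal{JS}_{2\ell-6}$; here $\mathcal{JS}_m=\mathbb{C}^m\oplus\mathbb{C}$ with $\mathbb{C}^m$ carrying a nondegenerate symmetric bilinear form $\langle\cdot,\cdot\rangle$ and $\mathfrak{C}(t^3)=\langle v,v\rangle\lambda$ for $t=(v,\lambda)$. $G_2$: $W=\mathcal{J}_3(\emptyset)=\mathbb{C}$, $\mathfrak{C}(t^3)=t^3/3$. $D_4$: $W$ = diagonal $3\times3$ matrices, $\mathfrak{C}(t^3)=\det(t)$. $F_4,E_6,E_7,E_8$: $W$ = $3\times 3$ $\mathbb{A}$-Hermitian matrices with $\mathbb{A}=\mathbb{A}_{\mathbb{R}}\otimes_{\mathbb{R}}\mathbb{C}$ and $\mathbb{A}_{\mathbb{R}}=\mathbb{R},\mathbb{C},\mathbb{H},\mathbb{O}$ respectively, $\mathfrak{C}(t^3)=\det(t)$ defined by $t^3-\mathrm{tr}(t)t^2-\frac12(\mathrm{tr}(t^2)-\mathrm{tr}(t)^2)t-\det(t)\,\mathrm{id}=0$. (The excluded cases $W=\mathcal{J}_3(\emptyset)$ and $W=\mathcal{JS}_1$ correspond to $G=G_2$ and $G=B_3$.) With a basis $\{\mathsf{w}_a\}_{a=1}^{n-1}$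 of $W$ and $t=t^a\mathsf{w}_a$: $\mathfrak{C}(t^3)=\mathfrak{C}_{abc}t^at^bt^c$, $\mathfrak{C}_a(t^2)=\mathfrak{C}_{abc}t^bt^c$, $\mathfrak{C}_{ab}(t)=\mathfrak{C}_{abc}t^c$; also $X=X^a\mathsf{w}_a$, $T=T^a\mathsf{w}_a$. In the Monge equations $Z,U,T^c$ are functions of $X=(X^a)$, with $Z_a=\partial Z/\partial X^a$, $U_{ab}=\partial^2U/\partial X^a\partial X^b$; the displayed first-order equation on $T$ is their compatibility condition. In the solution formulas, $\lambda,\mu^a,\nu_a$ and the two additive terms "const" are constants.
   Formalization: The printed Z and U do not solve the Monge equations (try λ=0, C_a(μ²)≠0); three coefficients are corrected: in Z, λ/2 becomes 3λ/2 before C_a(X²)μ^a and 1 becomes 3/2 before C_ab(X)μ^aμ^b; in U, 1/2 becomes 3/2 before C_a(X²)μ^a. *)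

theory Defs
  imports "HOL-Analysis.Analysis" "HOL-Library.Function_Algebras"
begin

section \<open>Complexified division algebras\<close>

text \<open>
  The Cayley--Dickson doubling. All operations are complex (bi)linear: the algebras below are
  \<open>\<real> \<otimes> \<complex>\<close>, \<open>\<complex> \<otimes> \<complex>\<close>, \<open>\<H> \<otimes> \<complex>\<close> and \<open>\<O> \<otimes> \<complex>\<close> (tensor products over the reals), and the
  conjugation is the complex linear extension of the conjugation of the real algebra. In
  particular it is the identity, and not \<open>cnj\<close>, on the scalars.
\<close>

definition cd_mult ::
  "('a::ab_group_add \<Rightarrow> 'a \<Rightarrow> 'a) \<Rightarrow> ('a \<Rightarrow> 'a) \<Rightarrow> 'a \<times> 'a \<Rightarrow> 'a \<times> 'a \<Rightarrow> 'a \<times> 'a" where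
  "cd_mult m k x y =
    (m (fst x) (fst y) - m (k (snd y)) (snd x), m (snd y) (fst x) + m (snd x) (k (fst y)))"

definition cd_conj :: "('a::ab_group_add \<Rightarrow> 'a) \<Rightarrow> 'a \<times> 'a \<Rightarrow> 'a \<times> 'a" where
  "cd_conj k x = (k (fst x), - snd x)"

type_synonym ccplx = "complex \<times> complex"
type_synonym cquat = "ccplx \<times> ccplx"
type_synonym coct = "cquat \<times> cquat"

definition ccplx_mult :: "ccplx \<Rightarrow> ccplx \<Rightarrow> ccplx" where
  "ccplx_mult = cd_mult (*) (\<lambda>z. z)"

definition ccplx_conj :: "ccplx \<Rightarrow> ccplx" where
  "ccplx_conj = cd_conj (\<lambda>z. z)"

definition cquat_mult :: "cquat \<Rightarrow> cquat \<Rightarrow> cquat" where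
  "cquat_mult = cd_mult ccplx_mult ccplx_conj"

definition cquat_conj :: "cquat \<Rightarrow> cquat" where
  "cquat_conj = cd_conj ccplx_conj"

definition coct_mult :: "coct \<Rightarrow> coct \<Rightarrow> coct" where
  "coct_mult = cd_mult cquat_mult cquat_conj"

definition coct_conj :: "coct \<Rightarrow> coct" where
  "coct_conj = cd_conj cquat_conj"

definition coct_of :: "complex \<Rightarrow> coct" where
  "coct_of z = (((z, 0), 0), 0)"

definition coct_scalar_part :: "coct \<Rightarrow> complex" where
  "coct_scalar_part x = fst (fst (fst x))"

definition coct_scale :: "complex \<Rightarrow> coct \<Rightarrow> coct" where
  "coct_scale c = (let d = map_prod ((*) c) ((*) c); q = map_prod d d in map_prod q q)"

datatype div_alg = Reals | Complexes | Quaternions | Octonions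

text \<open>The four algebras, realized as a chain of subalgebras of \<open>\<O> \<otimes> \<complex>\<close>.\<close>

fun cdiv_alg :: "div_alg \<Rightarrow> coct set" where
  "cdiv_alg Reals = range coct_of"
| "cdiv_alg Complexes = range (\<lambda>x. ((x, 0), 0))"
| "cdiv_alg Quaternions = range (\<lambda>x. (x, 0))"
| "cdiv_alg Octonions = UNIV"


section \<open>Hermitian matrices of size three\<close>

definition mat3_scale :: "('c \<Rightarrow> 'a \<Rightarrow> 'a) \<Rightarrow> 'c \<Rightarrow> 'a^3^3 \<Rightarrow> 'a^3^3" where
  "mat3_scale s c M = (\<chi> i j. s c (M $ i $ j))"

definition hermitian3 :: "div_alg \<Rightarrow> (coct^3^3) set" where
  "hermitian3 A = {M. \<forall>i j. M $ i $ j \<in> cdiv_alg A \<and> M $ j $ i = coct_conj (M $ i $ j)}"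

definition coct_matmul :: "coct^3^3 \<Rightarrow> coct^3^3 \<Rightarrow> coct^3^3" where
  "coct_matmul M N = (\<chi> i j. \<Sum>k\<in>UNIV. coct_mult (M $ i $ k) (N $ k $ j))"

definition jordan_mult :: "coct^3^3 \<Rightarrow> coct^3^3 \<Rightarrow> coct^3^3" where
  "jordan_mult M N = mat3_scale coct_scale (1/2) (coct_matmul M N + coct_matmul N M)"

text \<open>The diagonal entries of a Hermitian matrix are scalars, so nothing is lost here.\<close>

definition hermitian3_trace :: "coct^3^3 \<Rightarrow> complex" where
  "hermitian3_trace M = (\<Sum>i\<in>UNIV. coct_scalar_part (M $ i $ i))"

text \<open>
  The determinant is the constant term of the generic cubic equation. Powers are taken in the
  Jordan algebra: over the octonions the two associations of the ordinary matrix cube differ.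
\<close>

definition hermitian3_det :: "coct^3^3 \<Rightarrow> complex" where
  "hermitian3_det M = (THE d.
     let sc = mat3_scale coct_scale;
         M2 = jordan_mult M M;
         M3 = jordan_mult M M2
     in M3 - sc (hermitian3_trace M) M2
          - sc (1/2 * (hermitian3_trace M2 - (hermitian3_trace M)\<^sup>2)) M
          - sc d (\<chi> i j. if i = j then coct_of 1 else 0) = 0)"


section \<open>The vector space with cubic form attached to a simple Lie group\<close>

datatype lie_type = TypeB nat | TypeD nat | TypeG2 | TypeF4 | TypeE6 | TypeE7 | TypeE8

datatype jordan_alg =
    JS nat
  | J3_empty
  | J3_diag
  | J3 div_alg

inductive associated_jordan :: "lie_type \<Rightarrow> jordan_alg \<Rightarrow> bool" where
  "l \<ge> 3 \<Longrightarrow> associated_jordan (TypeB l) (JS (2 * l - 5))"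
| "l \<ge> 5 \<Longrightarrow> associated_jordan (TypeD l) (JS (2 * l - 6))"
| "associated_jordan (TypeD 4) J3_diag"
| "associated_jordan TypeG2 J3_empty"
| "associated_jordan TypeF4 (J3 Reals)"
| "associated_jordan TypeE6 (J3 Complexes)"
| "associated_jordan TypeE7 (J3 Quaternions)"
| "associated_jordan TypeE8 (J3 Octonions)"

text \<open>The space \<open>\<complex>\<^sup>m\<close> for a value \<open>m\<close>, as the sequences supported on \<open>{..<m}\<close>.\<close>

definition cspace :: "nat \<Rightarrow> (nat \<Rightarrow> complex) set" where
  "cspace m = {v. \<forall>i\<ge>m. v i = 0}"

definition seq_scale :: "complex \<Rightarrow> (nat \<Rightarrow> complex) \<Rightarrow> nat \<Rightarrow> complex" where
  "seq_scale c v = (\<lambda>i. c * v i)"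

definition nondegenerate_symmetric_form ::
  "nat \<Rightarrow> ((nat \<Rightarrow> complex) \<Rightarrow> (nat \<Rightarrow> complex) \<Rightarrow> complex) \<Rightarrow> bool" where
  "nondegenerate_symmetric_form m B \<longleftrightarrow>
     (\<forall>u\<in>cspace m. \<forall>v\<in>cspace m. \<forall>w\<in>cspace m. B (u + v) w = B u w + B v w) \<and>
     (\<forall>c. \<forall>v\<in>cspace m. \<forall>w\<in>cspace m. B (seq_scale c v) w = c * B v w) \<and>
     (\<forall>v\<in>cspace m. \<forall>w\<in>cspace m. B v w = B w v) \<and>
     (\<forall>v\<in>cspace m. (\<forall>w\<in>cspace m. B v w = 0) \<longrightarrow> v = 0)"

definition indexed_basis ::
  "(complex \<Rightarrow> 'v::ab_group_add \<Rightarrow> 'v) \<Rightarrow> 'v set \<Rightarrow> ('i \<Rightarrow> 'v) \<Rightarrow> bool" where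
  "indexed_basis smul W w \<longleftrightarrow>
     inj w \<and> \<not> module.dependent smul (range w) \<and> module.span smul (range w) = W"

text \<open>
  \<open>components_in_basis smul W cub w C\<close>: the cubic form \<open>cub\<close> on \<open>W\<close> is
  \<open>C\<^sub>a\<^sub>b\<^sub>c t\<^sup>a t\<^sup>b t\<^sup>c\<close>, with symmetric \<open>C\<close>, in the coordinates given by the basis \<open>w\<close>.
\<close>

definition components_in_basis ::
  "(complex \<Rightarrow> 'v::ab_group_add \<Rightarrow> 'v) \<Rightarrow> 'v set \<Rightarrow> ('v \<Rightarrow> complex) \<Rightarrow> ('i::finite \<Rightarrow> 'v)
     \<Rightarrow> ('i \<Rightarrow> 'i \<Rightarrow> 'i \<Rightarrow> complex) \<Rightarrow> bool" where
  "components_in_basis smul W cub w C \<longleftrightarrow>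
     indexed_basis smul W w \<and>
     (\<forall>a b c. C a b c = C b a c \<and> C a b c = C a c b) \<and>
     (\<forall>t :: complex^'i. cub (\<Sum>a\<in>UNIV. smul (t $ a) (w a)) =
        (\<Sum>a\<in>UNIV. \<Sum>b\<in>UNIV. \<Sum>c\<in>UNIV. C a b c * t $ a * t $ b * t $ c))"

text \<open>
  \<open>cubic_components J C\<close>: \<open>C\<close> is the array of components, in some basis indexed by \<open>'i\<close>, of the
  cubic form of \<open>J\<close>. For \<open>JS m\<close> the nondegenerate symmetric form on \<open>\<complex>\<^sup>m\<close> is arbitrary.
  Since \<open>'i\<close> indexes a basis, its cardinality is the dimension of \<open>J\<close>.
\<close>

fun cubic_components :: "jordan_alg \<Rightarrow> ('i::finite \<Rightarrow> 'i \<Rightarrow> 'i \<Rightarrow> complex) \<Rightarrow> bool" where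
  "cubic_components (JS m) C \<longleftrightarrow>
     (\<exists>B. nondegenerate_symmetric_form m B \<and>
       (\<exists>w. components_in_basis (\<lambda>c (v, s). (seq_scale c v, c * s)) (cspace m \<times> UNIV)
              (\<lambda>(v, s). B v v * s) w C))"
| "cubic_components J3_empty C \<longleftrightarrow>
     (\<exists>w. components_in_basis (*) UNIV (\<lambda>t. t ^ 3 / 3) w C)"
| "cubic_components J3_diag C \<longleftrightarrow>
     (\<exists>w. components_in_basis (mat3_scale (*)) {M. \<forall>i j. i \<noteq> j \<longrightarrow> M $ i $ j = 0} det w C)"
| "cubic_components (J3 A) C \<longleftrightarrow>
     (\<exists>w. components_in_basis (mat3_scale coct_scale) (hermitian3 A) hermitian3_det w C)"


section \<open>Contractions of the cubic form\<close>

text \<open>\<open>cub3 C t\<close>, \<open>cub2 C a t\<close> and \<open>cub1 C a b t\<close> are \<open>\<CC>(t\<^sup>3)\<close>, \<open>\<CC>\<^sub>a(t\<^sup>2)\<close> and \<open>\<CC>\<^sub>a\<^sub>b(t)\<close>.\<close>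

definition cub3 :: "('i::finite \<Rightarrow> 'i \<Rightarrow> 'i \<Rightarrow> complex) \<Rightarrow> complex^'i \<Rightarrow> complex" where
  "cub3 C t = (\<Sum>a\<in>UNIV. \<Sum>b\<in>UNIV. \<Sum>c\<in>UNIV. C a b c * t $ a * t $ b * t $ c)"

definition cub2 :: "('i::finite \<Rightarrow> 'i \<Rightarrow> 'i \<Rightarrow> complex) \<Rightarrow> 'i \<Rightarrow> complex^'i \<Rightarrow> complex" where
  "cub2 C a t = (\<Sum>b\<in>UNIV. \<Sum>c\<in>UNIV. C a b c * t $ b * t $ c)"

definition cub1 :: "('i::finite \<Rightarrow> 'i \<Rightarrow> 'i \<Rightarrow> complex) \<Rightarrow> 'i \<Rightarrow> 'i \<Rightarrow> complex^'i \<Rightarrow> complex" where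
  "cub1 C a b t = (\<Sum>c\<in>UNIV. C a b c * t $ c)"


section \<open>Holomorphic functions of several variables and the Monge equations\<close>

definition holomorphic_cn :: "(complex^'i::finite \<Rightarrow> complex) \<Rightarrow> (complex^'i) set \<Rightarrow> bool" where
  "holomorphic_cn f S \<longleftrightarrow>
     (\<forall>X\<in>S. \<exists>D. (f has_derivative D) (at X) \<and> (\<forall>c v. D (c *s v) = c * D v))"

definition pd :: "'i::finite \<Rightarrow> (complex^'i \<Rightarrow> complex) \<Rightarrow> complex^'i \<Rightarrow> complex" where
  "pd a f X = deriv (\<lambda>h. f (X + axis a h)) 0"

definition monge_equations ::
  "('i::finite \<Rightarrow> 'i \<Rightarrow> 'i \<Rightarrow> complex) \<Rightarrow> (complex^'i) set \<Rightarrow> (complex^'i \<Rightarrow> complex)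
     \<Rightarrow> (complex^'i \<Rightarrow> complex) \<Rightarrow> (complex^'i \<Rightarrow> complex^'i) \<Rightarrow> bool" where
  "monge_equations C S Z U T \<longleftrightarrow>
     (\<forall>X\<in>S. (\<forall>a. pd a Z X = 3/2 * cub2 C a (T X)) \<and>
             (\<forall>a b. pd a (pd b U) X = 3 * cub1 C a b (T X)))"

text \<open>The constants \<open>(\<lambda>, \<mu>, \<nu>, k\<^sub>1, k\<^sub>2)\<close>; \<open>k\<^sub>1\<close> and \<open>k\<^sub>2\<close> are the additive ones in \<open>Z\<close> and \<open>U\<close>.\<close>

type_synonym 'i constants = "complex \<times> (complex^'i) \<times> (complex^'i) \<times> complex \<times> complex"

fun constants_scale :: "complex \<Rightarrow> 'i::finite constants \<Rightarrow> 'i constants" where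
  "constants_scale c (l, \<mu>, \<nu>, k1, k2) = (c * l, c *s \<mu>, c *s \<nu>, c * k1, c * k2)"

fun solution_T :: "'i::finite constants \<Rightarrow> complex^'i \<Rightarrow> complex^'i" where
  "solution_T (l, \<mu>, \<nu>, k1, k2) X = l *s X + \<mu>"

text \<open>
  The coefficients \<open>3/2\<close> are forced by the Monge equations: for example \<open>\<CC>\<^sub>a(X\<^sup>2) \<mu>\<^sup>a\<close> has second
  derivatives \<open>2 \<CC>\<^sub>a\<^sub>b(\<mu>)\<close>, whereas those of \<open>U\<close> at \<open>X = 0\<close> must be \<open>3 \<CC>\<^sub>a\<^sub>b(\<mu>)\<close>.
\<close>

fun solution_Z ::
  "('i::finite \<Rightarrow> 'i \<Rightarrow> 'i \<Rightarrow> complex) \<Rightarrow> 'i constants \<Rightarrow> complex^'i \<Rightarrow> complex" where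
  "solution_Z C (l, \<mu>, \<nu>, k1, k2) X =
     l\<^sup>2 / 2 * cub3 C X + 3 * l / 2 * (\<Sum>a\<in>UNIV. cub2 C a X * \<mu> $ a)
       + 3 / 2 * (\<Sum>a\<in>UNIV. \<Sum>b\<in>UNIV. cub1 C a b X * \<mu> $ a * \<mu> $ b) + k1"

fun solution_U ::
  "('i::finite \<Rightarrow> 'i \<Rightarrow> 'i \<Rightarrow> complex) \<Rightarrow> 'i constants \<Rightarrow> complex^'i \<Rightarrow> complex" where
  "solution_U C (l, \<mu>, \<nu>, k1, k2) X =
     l / 2 * cub3 C X + 3 / 2 * (\<Sum>a\<in>UNIV. cub2 C a X * \<mu> $ a)
       + (\<Sum>a\<in>UNIV. \<nu> $ a * X $ a) + k2"

end

theory Submission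
  imports Defs "HOL-Complex_Analysis.Cauchy_Integral_Formula"
begin

text \<open>
  Write \<open>A\<close> for the matrix \<open>A\<^sup>c\<^sub>e = T\<^sup>c\<^sub>,\<^sub>e\<close> at a point. The first-order equation on \<open>T\<close> says exactly that
  \<open>\<CC>(x, A y, z) = \<CC>(x, y, A z)\<close> for all \<open>x\<close>, \<open>y\<close>, \<open>z\<close>, that is, that \<open>A\<close> lies in the centroid of the cubic
  form. For the cubic forms at hand the centroid consists of the scalar matrices
  (\<open>associated_jordan_scalar_centroid\<close>), so \<open>T\<^sup>c\<^sub>,\<^sub>e = L(X) \<delta>\<^sup>c\<^sub>e\<close>. Since \<open>dim W \<ge> 2\<close>, every index \<open>e\<close> differs from
  some \<open>c\<close>, and then \<open>\<partial>\<^sub>e L = \<partial>\<^sub>e \<partial>\<^sub>c T\<^sup>c = \<partial>\<^sub>c \<partial>\<^sub>e T\<^sup>c = 0\<close>. So \<open>L\<close> is a constant \<open>\<lambda>\<close>, and \<open>T - \<lambda> X\<close> is constant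
  (\<open>compatible_imp_affine\<close>).

  The equation \<open>U\<^sub>a\<^sub>b = 3 \<CC>\<^sub>a\<^sub>b(T)\<close> and the symmetry of third derivatives of \<open>U\<close> give the first-order
  equation, hence \<open>T = \<lambda> X + \<mu>\<close>. After that \<open>Z\<close>, the first derivatives of \<open>U\<close>, and \<open>U\<close> itself are each
  found by subtracting an explicit solution: what is left has vanishing partial derivatives and is
  constant (\<open>monge_imp_solution\<close>). That the constants are determined by the solution is a matter of
  nondegeneracy, and this again follows from the centroid: a vector \<open>v\<close> with \<open>\<CC>\<^sub>a\<^sub>b(v) = 0\<close> for all \<open>a\<close>
  and \<open>b\<close> makes every matrix of rank one with image spanned by \<open>v\<close> an element of the centroid, and
  such a matrix is not scalar in dimension at least two (\<open>nondegenerate_if_scalar_centroid\<close>).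

  The analytic part rests on a class of functions that contains the holomorphic ones and is closed
  under partial derivatives: locally bounded functions that are holomorphic in each variable. The
  equation for \<open>U\<close> speaks only of iterated derivatives in single variables, and Cauchy's estimates
  suffice to commute them (\<open>mixed_pd\<close>) and to stay in the class (\<open>separately_holomorphic_pd\<close>).

  The centroid is computed without coordinates. Polarizing the cubic form at the three diagonal
  idempotents \<open>e\<^sub>i\<close> of a Hermitian or diagonal \<open>3 \<times> 3\<close> matrix algebra gives very sparse bilinear
  forms, which force a self-adjoint map to fix the line of each \<open>e\<^sub>i\<close>, with one common eigenvalue, and
  then to be scalar (\<open>self_adjoint_scalar_if_frame\<close>). This needs an explicit formula for the
  determinant, which comes from the generic cubic equation over the octonions
  (\<open>generic_cubic_equation\<close>). For the spin factors \<open>\<langle>v, v\<rangle> \<lambda>\<close> the computation is direct and uses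
  \<open>m \<ge> 2\<close> (\<open>spin_self_adjoint_scalar\<close>).
\<close>

section \<open>Bounded functions of two complex variables\<close>

text \<open>
  Cauchy's estimate. The bound \<open>M + 1\<close> instead of \<open>M\<close> makes the inequality on the values strict.
\<close>

lemma deriv_bound_ball:
  fixes f :: "complex \<Rightarrow> complex"
  assumes "f holomorphic_on ball z R" "\<And>w. w \<in> ball z R \<Longrightarrow> norm (f w) \<le> M" "0 < r" "r < R" "0 < n"
  shows "norm ((deriv ^^ n) f z) \<le> fact n * (M + 1) / r ^ n"
proof (rule Cauchy_higher_deriv_bound[where y = 0])
  show "f holomorphic_on ball z r"
    using assms by (auto intro: holomorphic_on_subset)
  show "continuous_on (cball z r) f"
    by (rule continuous_on_subset[OF holomorphic_on_imp_continuous_on[OF assms(1)]]) (use assms in auto)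
  show "f w \<in> ball 0 (M + 1)" if "w \<in> ball z r" for w
    using assms(2)[of w] that assms(4) by auto
qed (use assms in auto)

text \<open>
  The error of a difference quotient is linear in \<open>h\<close> with a constant depending only on the radius and the bound
  for \<open>f\<close>; applied to a family of functions with a common bound, it gives uniform convergence.
\<close>

lemma difference_quotient_error:
  fixes f :: "complex \<Rightarrow> complex"
  assumes hol: "f holomorphic_on ball 0 r" and M: "\<And>w. w \<in> ball 0 r \<Longrightarrow> norm (f w) \<le> M"
    and r: "0 < r" and h: "norm h < r/2" "h \<noteq> 0"
  shows "norm ((f h - f 0) / h - deriv f 0) \<le> 32 * (M + 1) / r\<^sup>2 * norm h"
proof -
  \<comment> \<open>Cauchy's estimate \<open>2! (M + 1) / (r/4)\<^sup>2\<close> for the second derivative at the points of norm below \<open>r/2\<close>\<close>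
  define B where "B = 32 * (M + 1) / r\<^sup>2"
  have "norm (f h - (\<Sum>i\<le>1. (deriv ^^ i) f 0 * (h - 0) ^ i / fact i)) \<le> B * norm (h - 0) ^ Suc 1 / fact 1"
  proof (rule complex_Taylor[where S = "ball 0 (r/2)" and f = "\<lambda>i. (deriv ^^ i) f" and n = 1, simplified funpow_0])
    fix i and x :: complex assume x: "x \<in> ball 0 (r/2)"
    then have "x \<in> ball 0 r" using r by auto
    then show "((deriv ^^ i) f has_field_derivative (deriv ^^ Suc i) f x) (at x within ball 0 (r/2))"
      using holomorphic_derivI[OF holomorphic_higher_deriv[OF hol] _ \<open>x \<in> ball 0 r\<close>]
      by (simp add: has_field_derivative_at_within)
  next
    fix x :: complex assume x: "x \<in> ball 0 (r/2)"
    have sub: "ball x (r/2) \<subseteq> ball 0 r"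
      using x by (auto simp: ball_subset_ball_iff)
    have "norm ((deriv ^^ 2) f x) \<le> fact 2 * (M + 1) / (r/4) ^ 2"
      by (rule deriv_bound_ball[where R = "r/2"])
        (use hol M sub r in \<open>auto intro: holomorphic_on_subset\<close>)
    then show "norm ((deriv ^^ Suc 1) f x) \<le> B"
      by (simp add: B_def power2_eq_square numeral_2_eq_2)
  qed (use h r in auto)
  then have "norm (f h - (f 0 + deriv f 0 * h)) \<le> B * norm h * norm h"
    by (simp add: power2_eq_square)
  moreover have "(f h - f 0) / h - deriv f 0 = (f h - (f 0 + deriv f 0 * h)) / h"
    using h by (simp add: field_simps)
  ultimately show ?thesis
    using h by (simp add: norm_divide B_def divide_le_eq)
qed

text \<open>
  As \<open>h\<close> tends to \<open>0\<close>, the quotients \<open>(F s h - F s 0) / h\<close> converge to the derivative of \<open>F s\<close> at \<open>0\<close>, uniformly in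
  \<open>s\<close> because \<open>F\<close> is bounded. By Weierstrass the limit is holomorphic in \<open>s\<close>, and its derivative is
  the limit of the derivatives in \<open>s\<close>, which are difference quotients in \<open>h\<close> for the other first
  partial derivative. So both mixed derivatives exist and agree.
\<close>

lemma mixed_derivatives_of_bounded_function:
  fixes F :: "complex \<Rightarrow> complex \<Rightarrow> complex"
  assumes r: "0 < r"
    and hol1: "\<And>t. t \<in> ball 0 r \<Longrightarrow> (\<lambda>s. F s t) holomorphic_on ball 0 r"
    and hol2: "\<And>s. s \<in> ball 0 r \<Longrightarrow> F s holomorphic_on ball 0 r"
    and M: "\<And>s t. s \<in> ball 0 r \<Longrightarrow> t \<in> ball 0 r \<Longrightarrow> norm (F s t) \<le> M"
  obtains D where "((\<lambda>s. deriv (F s) 0) has_field_derivative D) (at 0)"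
    and "((\<lambda>t. deriv (\<lambda>s. F s t) 0) has_field_derivative D) (at 0)"
proof -
  define Q where "Q h s = (F s h - F s 0) / h" for h s
  define Q' where "Q' h s = (deriv (\<lambda>s. F s h) s - deriv (\<lambda>s. F s 0) s) / h" for h s
  have near: "eventually (\<lambda>h. h \<in> ball 0 (r/2) \<and> h \<noteq> 0) (at (0::complex))"
    using r by (auto simp: eventually_at intro!: exI[of _ "r/2"])
  have Q: "(Q h has_field_derivative Q' h s) (at s)"
    if "h \<in> ball 0 (r/2)" "s \<in> ball 0 r" for h s
  proof -
    have "((\<lambda>s. F s h) has_field_derivative deriv (\<lambda>s. F s h) s) (at s)"
      "((\<lambda>s. F s 0) has_field_derivative deriv (\<lambda>s. F s 0) s) (at s)"
      using that r by (auto intro!: holomorphic_derivI[OF hol1])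
    then show ?thesis
      unfolding Q_def Q'_def by (intro DERIV_cdivide DERIV_diff)
  qed
  have M0: "M \<ge> 0"
    using M[of 0 0] norm_ge_zero[of "F 0 0"] r by (auto simp del: norm_ge_zero)
  have "uniform_limit (cball 0 (r/2)) Q (\<lambda>s. deriv (F s) 0) (at 0)"
  proof (rule uniform_limitI)
    fix e :: real assume e: "0 < e"
    define K where "K = 32 * (M + 1) / r\<^sup>2"
    have K: "K > 0" using M0 r by (simp add: K_def)
    have "eventually (\<lambda>h. h \<in> ball 0 (e / K)) (at (0::complex))"
      using e K by (auto simp: eventually_at intro!: exI[of _ "e/K"])
    with near show "\<forall>\<^sub>F h in at 0. \<forall>s\<in>cball 0 (r/2). dist (Q h s) (deriv (F s) 0) < e"
    proof eventually_elim
      case (elim h)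
      show ?case
      proof
        fix s :: complex assume "s \<in> cball 0 (r/2)"
        then have s: "s \<in> ball 0 r" using r by auto
        have "norm (Q h s - deriv (F s) 0) \<le> K * norm h"
          unfolding Q_def K_def
          by (rule difference_quotient_error) (use hol2[OF s] M s r elim in auto)
        also have "\<dots> < e"
          using elim K by (simp add: pos_less_divide_eq mult.commute)
        finally show "dist (Q h s) (deriv (F s) 0) < e" by (simp add: dist_norm)
      qed
    qed
  qed
  moreover have "eventually (\<lambda>h. continuous_on (cball 0 (r/2)) (Q h) \<and>
      (\<forall>s \<in> ball 0 (r/2). (Q h has_field_derivative Q' h s) (at s))) (at 0)"
    using near
  proof eventually_elim
    case (elim h)
    have *: "s \<in> ball 0 r" if "s \<in> cball 0 (r/2)" for s :: complex
      using that r by auto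
    show ?case
      using Q[of h] elim * DERIV_isCont
      by (force intro!: continuous_at_imp_continuous_on)
  qed
  ultimately obtain g' where g': "\<And>s. s \<in> ball 0 (r/2) \<Longrightarrow>
      ((\<lambda>s. deriv (F s) 0) has_field_derivative g' s) (at s) \<and> ((\<lambda>h. Q' h s) \<longlongrightarrow> g' s) (at 0)"
    using has_complex_derivative_uniform_limit[of 0 "r/2" Q Q' "at 0" "\<lambda>s. deriv (F s) 0"] r
    by auto
  show ?thesis
    by (rule that[of "g' 0"]) (use g'[of 0] r in \<open>auto simp: Q'_def DERIV_def\<close>)
qed

section \<open>Partial derivatives and separate holomorphy\<close>

text \<open>
  The operator \<open>pd\<close> has a value even where there is no derivative; this predicate also asserts
  differentiability along the axis.
\<close>

definition has_pd :: "'i::finite \<Rightarrow> (complex^'i \<Rightarrow> complex) \<Rightarrow> complex \<Rightarrow> complex^'i \<Rightarrow> bool" where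
  "has_pd a f D X \<longleftrightarrow> ((\<lambda>h. f (X + axis a h)) has_field_derivative D) (at 0)"

lemma has_pd_imp_pd: "has_pd a f D X \<Longrightarrow> pd a f X = D"
  by (simp add: has_pd_def pd_def DERIV_imp_deriv)

lemma norm_axis_complex [simp]: "norm (axis a (h::complex)) = norm h"
proof -
  have "(\<Sum>i\<in>UNIV. (norm (axis a h $ i))\<^sup>2) = (\<Sum>i\<in>UNIV. if i = a then (norm h)\<^sup>2 else 0)"
    by (intro sum.cong) (auto simp: axis_def)
  then show ?thesis
    by (simp add: norm_vec_def L2_set_def)
qed

lemma has_pd_cong:
  assumes "has_pd a f D X" "open S" "X \<in> S" "\<And>Y. Y \<in> S \<Longrightarrow> f Y = g Y"
  shows "has_pd a g D X"
proof -
  obtain r where r: "r > 0" "ball X r \<subseteq> S" using assms openE by blast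
  show ?thesis
    unfolding has_pd_def
  proof (rule has_field_derivative_transform_within_open)
    show "((\<lambda>h. f (X + axis a h)) has_field_derivative D) (at 0)"
      using assms by (simp add: has_pd_def)
    fix h :: complex assume "h \<in> ball 0 r"
    then have "X + axis a h \<in> S"
      using r by (auto simp: dist_norm subset_iff)
    then show "f (X + axis a h) = g (X + axis a h)" by (rule assms)
  qed (use r in auto)
qed

lemma pd_cong:
  assumes "open S" "X \<in> S" "\<And>Y. Y \<in> S \<Longrightarrow> f Y = g Y"
  shows "pd a f X = pd a g X"
proof -
  have "has_pd a f D X \<longleftrightarrow> has_pd a g D X" for D
    using has_pd_cong[OF _ assms(1,2), of a f D g] has_pd_cong[OF _ assms(1,2), of a g D f] assms(3)
    by auto
  then show ?thesis
    by (simp add: pd_def deriv_def has_pd_def)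
qed

text \<open>
  Local boundedness is what makes Cauchy's estimates uniform in the remaining variables. By theorems
  of Osgood and Hartogs this class is that of the holomorphic functions on an open set; the form
  chosen here is the one for which closure under \<open>pd\<close> is easy to see.
\<close>

definition separately_holomorphic :: "(complex^'i::finite \<Rightarrow> complex) \<Rightarrow> (complex^'i) set \<Rightarrow> bool" where
  "separately_holomorphic f S \<longleftrightarrow>
     (\<forall>X\<in>S. (\<forall>a. \<exists>D. has_pd a f D X) \<and> (\<exists>r>0. \<exists>M. \<forall>Y\<in>ball X r. norm (f Y) \<le> M))"

lemma has_pd_pd:
  assumes "separately_holomorphic f S" "X \<in> S"
  shows "has_pd a f (pd a f X) X"
proof -
  obtain D where "has_pd a f D X" using assms unfolding separately_holomorphic_def by blast
  then show ?thesis using has_pd_imp_pd[of a f D X] by simp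
qed

lemma holomorphic_cn_imp_separately_holomorphic:
  assumes "holomorphic_cn f S"
  shows "separately_holomorphic f S"
  unfolding separately_holomorphic_def
proof (intro ballI conjI allI)
  fix X a assume "X \<in> S"
  then obtain D where D: "(f has_derivative D) (at X)" and lin: "\<And>c v. D (c *s v) = c * D v"
    using assms unfolding holomorphic_cn_def by blast
  have "((\<lambda>h. X + axis a h) has_derivative (\<lambda>h. axis a h)) (at 0)"
    by (auto intro!: derivative_eq_intros bounded_linear_imp_has_derivative linearI
        simp: linear_conv_bounded_linear[symmetric] axis_def vec_eq_iff)
  from diff_chain_at[OF this, of f D] D
  have "((\<lambda>h. f (X + axis a h)) has_derivative (\<lambda>h. D (axis a h))) (at 0)"
    by (simp add: o_def axis_def zero_vec_def[symmetric])
  moreover have "(\<lambda>h. D (axis a h)) = (*) (D (axis a 1))"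
  proof
    fix h :: complex
    have "axis a h = h *s axis a 1" by (simp add: axis_def vec_eq_iff)
    then show "D (axis a h) = D (axis a 1) * h" using lin[of h "axis a 1"] by (simp only: mult.commute)
  qed
  ultimately have "has_pd a f (D (axis a 1)) X"
    by (simp add: has_pd_def has_field_derivative_def)
  then show "\<exists>D. has_pd a f D X" ..
next
  fix X assume "X \<in> S"
  then obtain D where "(f has_derivative D) (at X)"
    using assms unfolding holomorphic_cn_def by blast
  then have "isCont f X" by (rule has_derivative_continuous)
  then have "\<exists>r>0. \<forall>Y. dist Y X < r \<longrightarrow> dist (f Y) (f X) < 1"
    unfolding continuous_at_eps_delta by (drule_tac spec[of _ 1]) simp
  then obtain r where "r > 0" and *: "\<And>Y. dist Y X < r \<Longrightarrow> dist (f Y) (f X) < 1"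
    by blast
  then have "\<forall>Y\<in>ball X r. norm (f Y) \<le> norm (f X) + 1"
  proof (intro ballI)
    fix Y assume "Y \<in> ball X r"
    then have "norm (f Y - f X) < 1" using *[of Y] by (simp add: dist_norm norm_minus_commute)
    then show "norm (f Y) \<le> norm (f X) + 1"
      using norm_triangle_ineq2[of "f Y" "f X"] by simp
  qed
  with \<open>r > 0\<close> show "\<exists>r>0. \<exists>M. \<forall>Y\<in>ball X r. norm (f Y) \<le> M" by blast
qed

text \<open>
  Translating the base point along the axis turns differentiability at \<open>0\<close>, at every point of \<open>S\<close>, into
  holomorphy of the whole slice.
\<close>

lemma holomorphic_along_axis:
  assumes "separately_holomorphic f S" and sub: "\<And>h. h \<in> T \<Longrightarrow> X + axis a h \<in> S" and "open T"
  shows "(\<lambda>h. f (X + axis a h)) holomorphic_on T"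
    and "h \<in> T \<Longrightarrow> deriv (\<lambda>h. f (X + axis a h)) h = pd a f (X + axis a h)"
proof -
  have *: "((\<lambda>h. f (X + axis a h)) has_field_derivative pd a f (X + axis a h)) (at h)" if "h \<in> T" for h
  proof -
    have ax: "X + axis a h + axis a k = X + axis a (k + h)" for k
      by (simp add: axis_def vec_eq_iff)
    have "((\<lambda>k. f (X + axis a (k + h))) has_field_derivative pd a f (X + axis a h)) (at 0)"
      using has_pd_pd[OF assms(1) sub[OF that], of a] unfolding has_pd_def ax .
    then show ?thesis
      using DERIV_at_within_shift[of "\<lambda>h. f (X + axis a h)" _ h 0 UNIV] by (simp add: add.commute)
  qed
  show "(\<lambda>h. f (X + axis a h)) holomorphic_on T"
    using * \<open>open T\<close> by (auto simp: holomorphic_on_open)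
  show "h \<in> T \<Longrightarrow> deriv (\<lambda>h. f (X + axis a h)) h = pd a f (X + axis a h)"
    using * DERIV_imp_deriv by blast
qed

text \<open>
  On a small bidisc in the plane of the two axes the function is bounded and holomorphic in each
  variable. The case \<open>a = b\<close> is included.
\<close>

lemma mixed_pd:
  assumes f: "separately_holomorphic f S" and "open S" "X \<in> S"
  obtains D where "has_pd a (pd b f) D X" "has_pd b (pd a f) D X"
proof -
  obtain r1 M where r1: "r1 > 0" and M: "\<And>Y. Y \<in> ball X r1 \<Longrightarrow> norm (f Y) \<le> M"
    using f \<open>X \<in> S\<close> unfolding separately_holomorphic_def by blast
  obtain r2 where r2: "r2 > 0" "ball X r2 \<subseteq> S" using assms openE by blast
  define r where "r = min r1 r2 / 2"
  have r: "r > 0" using r1 r2 by (simp add: r_def)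
  define F where "F s t = f (X + axis a s + axis b t)" for s t
  have in_ball: "X + axis a s + axis b t \<in> ball X (min r1 r2)" if "s \<in> ball 0 r" "t \<in> ball 0 r" for s t
  proof -
    have "norm (axis a s + axis b t) \<le> norm s + norm t"
      using norm_triangle_ineq[of "axis a s" "axis b t"] by simp
    also have "\<dots> < min r1 r2" using that by (simp add: r_def)
    finally have "norm (- (axis a s + axis b t)) < min r1 r2"
      unfolding norm_minus_cancel .
    moreover have "X - (X + axis a s + axis b t) = - (axis a s + axis b t)" by simp
    ultimately show ?thesis by (simp only: mem_ball dist_norm)
  qed
  have in_S: "X + axis a s + axis b t \<in> S" "X + axis b t + axis a s \<in> S"
    if "s \<in> ball 0 r" "t \<in> ball 0 r" for s t
    using in_ball[OF that] r2 by (auto simp: add_ac)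
  have F2: "F s t = f (X + axis b t + axis a s)" for s t
    by (simp add: F_def add_ac)
  obtain D where D: "((\<lambda>s. deriv (F s) 0) has_field_derivative D) (at 0)"
    "((\<lambda>t. deriv (\<lambda>s. F s t) 0) has_field_derivative D) (at 0)"
  proof (rule mixed_derivatives_of_bounded_function[OF r, of F M])
    show "(\<lambda>s. F s t) holomorphic_on ball 0 r" if "t \<in> ball 0 r" for t
      unfolding F2 by (rule holomorphic_along_axis[OF f]) (use in_S that in auto)
    show "F s holomorphic_on ball 0 r" if "s \<in> ball 0 r" for s
      unfolding F_def by (rule holomorphic_along_axis[OF f]) (use in_S that in auto)
    show "norm (F s t) \<le> M" if "s \<in> ball 0 r" "t \<in> ball 0 r" for s t
      using in_ball[OF that] M by (auto simp: F_def)
  qed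
  have "F s = (\<lambda>h. f (X + axis a s + axis b h))" for s
    by (simp add: F_def fun_eq_iff)
  then have "deriv (F s) 0 = pd b f (X + axis a s)" "deriv (\<lambda>s. F s t) 0 = pd a f (X + axis b t)" for s t
    by (simp only: pd_def) (simp only: F2 pd_def)
  with D show ?thesis
    by (intro that[of D]) (auto simp: has_pd_def)
qed

text \<open>
  Partial derivatives exist by \<open>mixed_pd\<close>, and Cauchy's estimate turns a bound for \<open>f\<close> on a ball into
  one for its partial derivatives on a smaller ball.
\<close>

lemma separately_holomorphic_pd:
  assumes f: "separately_holomorphic f S" and S: "open S"
  shows "separately_holomorphic (pd b f) S"
  unfolding separately_holomorphic_def
proof (intro ballI conjI allI)
  fix X a assume "X \<in> S"
  then show "\<exists>D. has_pd a (pd b f) D X" using mixed_pd[OF f S, of X] by blast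
next
  fix X assume X: "X \<in> S"
  obtain r1 M where r1: "r1 > 0" and M: "\<And>Y. Y \<in> ball X r1 \<Longrightarrow> norm (f Y) \<le> M"
    using f X unfolding separately_holomorphic_def by blast
  obtain r2 where r2: "r2 > 0" "ball X r2 \<subseteq> S" using S X openE by blast
  define r where "r = min r1 r2 / 2"
  have r: "r > 0" using r1 r2 by (simp add: r_def)
  have "norm (pd b f Y) \<le> (M + 1) / (r/2)" if Y: "Y \<in> ball X r" for Y
  proof -
    have in_ball: "Y + axis b h \<in> ball X (min r1 r2)" if "h \<in> ball 0 r" for h
    proof -
      have "dist X (Y + axis b h) \<le> dist X Y + dist Y (Y + axis b h)" by (rule dist_triangle)
      also have "\<dots> < min r1 r2" using that Y by (simp add: r_def dist_norm)
      finally show ?thesis by simp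
    qed
    have "norm ((deriv ^^ 1) (\<lambda>h. f (Y + axis b h)) 0) \<le> fact 1 * (M + 1) / (r/2) ^ 1"
    proof (rule deriv_bound_ball[where R = r])
      show "(\<lambda>h. f (Y + axis b h)) holomorphic_on ball 0 r"
        by (rule holomorphic_along_axis[OF f]) (use in_ball r2 in auto)
    qed (use in_ball M r in auto)
    then show ?thesis by (simp add: pd_def)
  qed
  with r show "\<exists>r>0. \<exists>M. \<forall>Y\<in>ball X r. norm (pd b f Y) \<le> M" by blast
qed

lemma pd_commute:
  assumes "separately_holomorphic f S" "open S" "X \<in> S"
  shows "pd a (pd b f) X = pd b (pd a f) X"
  using mixed_pd[OF assms, of a b] has_pd_imp_pd by metis

text \<open>
  One moves from the centre of a ball to another of its points by
  changing one coordinate at a time. The intermediate points stay in the ball because each of their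
  coordinates lies between the two given ones.
\<close>

lemma zero_partials_imp_constant:
  fixes f :: "complex^'i::finite \<Rightarrow> complex"
  assumes S: "open S" "connected S" and pd0: "\<And>X a. X \<in> S \<Longrightarrow> has_pd a f 0 X"
    and XY: "X \<in> S" "Y \<in> S"
  shows "f X = f Y"
proof (rule connected_local_const[OF S(2) XY], intro ballI)
  fix X assume X: "X \<in> S"
  obtain r where r: "r > 0" "ball X r \<subseteq> S" using S X openE by blast
  have "f Y = f X" if Y: "Y \<in> ball X r" for Y
  proof -
    define Z where "Z A = (\<chi> i. if i \<in> A then Y $ i else X $ i)" for A :: "'i set"
    have "f (Z A) = f X" if "finite A" for A
      using that
    proof (induction A)
      case empty
      then show ?case by (simp add: Z_def)
    next
      case (insert a A)
      define d where "d = Y $ a - X $ a"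
      define g where "g h = f (Z A + axis a h)" for h
      have Zi: "Z (insert a A) = Z A + axis a d"
        using insert by (auto simp: Z_def vec_eq_iff axis_def d_def)
      have inS: "Z A + axis a h \<in> S" if "h \<in> closed_segment 0 d" for h
      proof -
        from that obtain u where u: "0 \<le> u" "u \<le> 1" "h = complex_of_real u * d"
          by (auto simp: closed_segment_def scaleR_conv_of_real)
        have hd: "norm h \<le> norm d"
          using u by (simp add: norm_mult mult_left_le_one_le)
        have "norm (Z A + axis a h - X) \<le> norm (Y - X)"
        proof (rule norm_le_componentwise_cart)
          fix i
          show "norm ((Z A + axis a h - X) $ i) \<le> norm ((Y - X) $ i)"
            using insert hd by (cases "i = a") (auto simp: Z_def axis_def d_def)
        qed
        then show ?thesis using Y r by (auto simp: dist_norm norm_minus_commute subset_iff)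
      qed
      have "\<exists>c. \<forall>h\<in>closed_segment 0 d. g h = c"
      proof (rule has_field_derivative_zero_constant)
        fix h assume "h \<in> closed_segment 0 d"
        from pd0[OF inS[OF this], of a]
        have "((\<lambda>k. f (Z A + axis a h + axis a k)) has_field_derivative 0) (at 0)"
          by (simp add: has_pd_def)
        moreover have "Z A + axis a h + axis a k = Z A + axis a (k + h)" for k
          by (simp add: axis_def vec_eq_iff)
        ultimately have "((\<lambda>k. g (k + h)) has_field_derivative 0) (at 0)"
          by (simp add: g_def)
        then have "(g has_field_derivative 0) (at h)"
          using DERIV_at_within_shift[of g _ h 0 UNIV] by (simp add: add.commute)
        then show "(g has_field_derivative 0) (at h within closed_segment 0 d)"
          by (rule has_field_derivative_at_within)
      qed auto
      then have "g d = g 0" by auto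
      then show ?case
        using insert.IH Zi by (simp add: g_def axis_def zero_vec_def[symmetric])
    qed
    from this[of UNIV] show ?thesis by (simp add: Z_def)
  qed
  then show "\<forall>\<^sub>F Y in at X within S. f X = f Y"
    unfolding eventually_at using r(1) by (metis dist_commute mem_ball)
qed

section \<open>Monge equations for a cubic form with scalar centroid\<close>

text \<open>
  The matrices \<open>A\<close> for which \<open>\<CC>(x, A y, z)\<close> is symmetric in \<open>y\<close> and \<open>z\<close> form the centroid of \<open>\<CC>\<close>. It contains
  the scalar matrices, and the property says that it contains nothing else.
\<close>

definition scalar_centroid :: "('i::finite \<Rightarrow> 'i \<Rightarrow> 'i \<Rightarrow> complex) \<Rightarrow> bool" where
  "scalar_centroid C \<longleftrightarrow>
     (\<forall>A :: 'i \<Rightarrow> 'i \<Rightarrow> complex.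
        (\<forall>a b e. (\<Sum>c\<in>UNIV. C a c b * A c e) = (\<Sum>c\<in>UNIV. C a c e * A c b)) \<longrightarrow>
        (\<exists>l. \<forall>c e. A c e = (if c = e then l else 0)))"

locale cubic_form =
  fixes C :: "'i::finite \<Rightarrow> 'i \<Rightarrow> 'i \<Rightarrow> complex"
  assumes sym12: "C a b c = C b a c" and sym23: "C a b c = C a c b"
begin

lemma sym13: "C a b c = C c b a"
  by (metis sym12 sym23)

end

lemma has_pd_const: "has_pd a (\<lambda>X. k) 0 X"
  by (simp add: has_pd_def)

lemma has_pd_component: "has_pd a (\<lambda>X. X $ c) (if c = a then 1 else 0) X"
  by (auto simp: has_pd_def axis_def intro!: derivative_eq_intros)

lemma has_pd_add: "has_pd a f D X \<Longrightarrow> has_pd a g E X \<Longrightarrow> has_pd a (\<lambda>X. f X + g X) (D + E) X"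
  unfolding has_pd_def by (rule DERIV_add)

lemma has_pd_diff: "has_pd a f D X \<Longrightarrow> has_pd a g E X \<Longrightarrow> has_pd a (\<lambda>X. f X - g X) (D - E) X"
  unfolding has_pd_def by (rule DERIV_diff)

lemma has_pd_mult:
  assumes "has_pd a f D X" "has_pd a g E X"
  shows "has_pd a (\<lambda>X. f X * g X) (D * g X + f X * E) X"
proof -
  have [simp]: "axis a 0 = (0 :: complex^'a)" by (simp add: axis_def vec_eq_iff)
  show ?thesis
    using DERIV_mult[OF assms[unfolded has_pd_def]]
    by (simp add: has_pd_def algebra_simps)
qed

lemma has_pd_cmult: "has_pd a f D X \<Longrightarrow> has_pd a (\<lambda>X. k * f X) (k * D) X"
  unfolding has_pd_def by (rule DERIV_cmult)

lemma has_pd_cmult_right: "has_pd a f D X \<Longrightarrow> has_pd a (\<lambda>X. f X * k) (D * k) X"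
  unfolding has_pd_def by (rule DERIV_cmult_right)

lemma has_pd_sum: "(\<And>i. i \<in> I \<Longrightarrow> has_pd a (f i) (D i) X) \<Longrightarrow> has_pd a (\<lambda>X. \<Sum>i\<in>I. f i X) (\<Sum>i\<in>I. D i) X"
  unfolding has_pd_def by (rule DERIV_sum)

lemmas has_pd_intros = has_pd_const has_pd_component has_pd_add has_pd_diff has_pd_cmult
  has_pd_cmult_right has_pd_sum

lemma has_pd_eqI: "has_pd a f D X \<Longrightarrow> D = E \<Longrightarrow> has_pd a f E X"
  by simp

lemma cub2_eq_cub1: "cub2 C a X = (\<Sum>b\<in>UNIV. X $ b * cub1 C a b X)"
  by (simp add: cub2_def cub1_def sum_distrib_left mult_ac)

lemma cub3_eq_cub2: "cub3 C X = (\<Sum>a\<in>UNIV. X $ a * cub2 C a X)"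
  by (simp add: cub3_def cub2_def sum_distrib_left mult_ac)

lemma cub1_linear: "cub1 C a b (l *s X + v) = l * cub1 C a b X + cub1 C a b v"
  by (simp add: cub1_def algebra_simps sum.distrib sum_distrib_left)

context cubic_form
begin

text \<open>
  The square of \<open>l X + v\<close> is expanded through the symmetry of \<open>C\<close>: this is why the derivative of
  \<open>solution_Z\<close> is the quadratic form at \<open>solution_T\<close>.
\<close>

lemma cub2_add:
  "cub2 C a (l *s X + v) = l\<^sup>2 * cub2 C a X + 2 * l * (\<Sum>b\<in>UNIV. cub1 C a b X * v $ b) + cub2 C a v"
proof -
  have swap: "(\<Sum>b\<in>UNIV. X $ b * cub1 C a b v) = (\<Sum>b\<in>UNIV. cub1 C a b X * v $ b)"
    unfolding cub1_def sum_distrib_left sum_distrib_right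
    by (subst sum.swap) (simp add: sym23[of a] mult_ac)
  have "cub2 C a (l *s X + v)
      = (\<Sum>b\<in>UNIV. l\<^sup>2 * (X $ b * cub1 C a b X) + l * (X $ b * cub1 C a b v)
          + l * (cub1 C a b X * v $ b) + v $ b * cub1 C a b v)"
    unfolding cub2_eq_cub1 cub1_linear
    by (intro sum.cong) (simp_all add: algebra_simps power2_eq_square)
  also have "\<dots> = l\<^sup>2 * cub2 C a X + l * (\<Sum>b\<in>UNIV. X $ b * cub1 C a b v)
      + l * (\<Sum>b\<in>UNIV. cub1 C a b X * v $ b) + cub2 C a v"
    by (simp add: sum.distrib sum_distrib_left cub2_eq_cub1)
  finally show ?thesis by (simp add: swap)
qed

lemma has_pd_cub1: "has_pd a (cub1 C b c) (C a b c) X"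
proof -
  have "has_pd a (\<lambda>X. cub1 C b c X) (\<Sum>d\<in>UNIV. C b c d * (if d = a then 1 else 0)) X"
    unfolding cub1_def by (intro has_pd_intros)
  moreover have "(\<Sum>d\<in>UNIV. C b c d * (if d = a then 1 else 0)) = C a b c"
    using sym13[of b c a] sym23[of a c b] by (simp add: if_distrib cong: if_cong)
  ultimately show ?thesis by simp
qed

lemma has_pd_cub2: "has_pd a (cub2 C b) (2 * cub1 C a b X) X"
proof -
  have "has_pd a (\<lambda>X. cub2 C b X)
      (\<Sum>c\<in>UNIV. (if c = a then 1 else 0) * cub1 C b c X + X $ c * C a b c) X"
    unfolding cub2_eq_cub1 by (intro has_pd_sum has_pd_mult has_pd_component has_pd_cub1)
  moreover have "(\<Sum>c\<in>UNIV. (if c = a then 1 else 0) * cub1 C b c X) = cub1 C a b X"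
    using sym12[of a b] by (simp add: if_distrib[of "\<lambda>x. x * _"] cub1_def cong: if_cong)
  ultimately show ?thesis
    by (simp add: sum.distrib) (simp add: cub1_def mult.commute)
qed

lemma has_pd_cub3: "has_pd a (cub3 C) (3 * cub2 C a X) X"
proof -
  have "has_pd a (\<lambda>X. cub3 C X)
      (\<Sum>c\<in>UNIV. (if c = a then 1 else 0) * cub2 C c X + X $ c * (2 * cub1 C a c X)) X"
    unfolding cub3_eq_cub2 by (intro has_pd_sum has_pd_mult has_pd_component has_pd_cub2)
  moreover have "(\<Sum>c\<in>UNIV. (if c = a then 1 else 0) * cub2 C c X) = cub2 C a X"
    by (simp add: if_distrib[of "\<lambda>x. x * _"] cong: if_cong)
  moreover have "(\<Sum>c\<in>UNIV. X $ c * (2 * cub1 C a c X)) = 2 * cub2 C a X"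
    by (simp add: cub2_eq_cub1 sum_distrib_left mult_ac)
  ultimately show ?thesis
    by (simp add: sum.distrib)
qed

lemma has_pd_solution_Z:
  "has_pd a (solution_Z C p) (3/2 * cub2 C a (solution_T p X)) X"
proof (cases p)
  case (fields l \<mu> \<nu> k1 k2)
  define s where "s = (\<Sum>b\<in>UNIV. cub1 C a b X * \<mu> $ b)"
  have Z: "solution_Z C p = (\<lambda>X. l\<^sup>2 / 2 * cub3 C X + 3 * l / 2 * (\<Sum>b\<in>UNIV. cub2 C b X * \<mu> $ b)
       + 3 / 2 * (\<Sum>b\<in>UNIV. \<Sum>c\<in>UNIV. cub1 C b c X * \<mu> $ b * \<mu> $ c) + k1)"
    by (simp add: fields fun_eq_iff)
  show ?thesis
    unfolding Z
  proof (rule has_pd_eqI)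
    show "has_pd a (\<lambda>X. l\<^sup>2 / 2 * cub3 C X + 3 * l / 2 * (\<Sum>b\<in>UNIV. cub2 C b X * \<mu> $ b)
         + 3 / 2 * (\<Sum>b\<in>UNIV. \<Sum>c\<in>UNIV. cub1 C b c X * \<mu> $ b * \<mu> $ c) + k1)
       (l\<^sup>2 / 2 * (3 * cub2 C a X) + 3 * l / 2 * (\<Sum>b\<in>UNIV. 2 * cub1 C a b X * \<mu> $ b)
         + 3 / 2 * (\<Sum>b\<in>UNIV. \<Sum>c\<in>UNIV. C a b c * \<mu> $ b * \<mu> $ c) + 0) X"
      by (intro has_pd_intros has_pd_cub3 has_pd_cub2 has_pd_cub1)
    have "(\<Sum>b\<in>UNIV. 2 * cub1 C a b X * \<mu> $ b) = 2 * s"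
      by (simp add: s_def sum_distrib_left mult_ac)
    moreover have "(\<Sum>b\<in>UNIV. \<Sum>c\<in>UNIV. C a b c * \<mu> $ b * \<mu> $ c) = cub2 C a \<mu>"
      by (simp add: cub2_def)
    moreover have "cub2 C a (solution_T p X) = l\<^sup>2 * cub2 C a X + 2 * l * s + cub2 C a \<mu>"
      by (simp add: fields cub2_add s_def)
    ultimately show "l\<^sup>2 / 2 * (3 * cub2 C a X) + 3 * l / 2 * (\<Sum>b\<in>UNIV. 2 * cub1 C a b X * \<mu> $ b)
         + 3 / 2 * (\<Sum>b\<in>UNIV. \<Sum>c\<in>UNIV. C a b c * \<mu> $ b * \<mu> $ c) + 0
       = 3/2 * cub2 C a (solution_T p X)"
      by (simp add: algebra_simps)
  qed
qed

text \<open>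
  The first partial derivatives of \<open>solution_U\<close>, named because the integration of \<open>U\<close> goes through them.
\<close>

definition solution_dU :: "'i \<Rightarrow> 'i constants \<Rightarrow> complex^'i \<Rightarrow> complex" where
  "solution_dU b p X = (case p of (l, \<mu>, \<nu>, k1, k2) \<Rightarrow>
     3 * l / 2 * cub2 C b X + 3 * (\<Sum>c\<in>UNIV. cub1 C b c X * \<mu> $ c) + \<nu> $ b)"

lemma has_pd_solution_U: "has_pd b (solution_U C p) (solution_dU b p X) X"
proof (cases p)
  case (fields l \<mu> \<nu> k1 k2)
  have U: "solution_U C p = (\<lambda>X. l / 2 * cub3 C X + 3 / 2 * (\<Sum>c\<in>UNIV. cub2 C c X * \<mu> $ c)
       + (\<Sum>c\<in>UNIV. \<nu> $ c * X $ c) + k2)"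
    by (simp add: fields fun_eq_iff)
  show ?thesis
    unfolding U
  proof (rule has_pd_eqI)
    show "has_pd b (\<lambda>X. l / 2 * cub3 C X + 3 / 2 * (\<Sum>c\<in>UNIV. cub2 C c X * \<mu> $ c)
         + (\<Sum>c\<in>UNIV. \<nu> $ c * X $ c) + k2)
       (l / 2 * (3 * cub2 C b X) + 3 / 2 * (\<Sum>c\<in>UNIV. 2 * cub1 C b c X * \<mu> $ c)
         + (\<Sum>c\<in>UNIV. \<nu> $ c * (if c = b then 1 else 0)) + 0) X"
      by (intro has_pd_intros has_pd_cub3 has_pd_cub2)
    have "(\<Sum>c\<in>UNIV. 2 * cub1 C b c X * \<mu> $ c) = 2 * (\<Sum>c\<in>UNIV. cub1 C b c X * \<mu> $ c)"
      by (simp add: sum_distrib_left mult_ac)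
    moreover have "(\<Sum>c\<in>UNIV. \<nu> $ c * (if c = b then 1 else 0)) = \<nu> $ b"
      by (simp add: if_distrib cong: if_cong)
    ultimately show "l / 2 * (3 * cub2 C b X) + 3 / 2 * (\<Sum>c\<in>UNIV. 2 * cub1 C b c X * \<mu> $ c)
         + (\<Sum>c\<in>UNIV. \<nu> $ c * (if c = b then 1 else 0)) + 0 = solution_dU b p X"
      by (simp add: fields solution_dU_def)
  qed
qed

lemma has_pd_solution_dU:
  "has_pd a (solution_dU b p) (3 * cub1 C a b (solution_T p X)) X"
proof (cases p)
  case (fields l \<mu> \<nu> k1 k2)
  have dU: "solution_dU b p = (\<lambda>X. 3 * l / 2 * cub2 C b X + 3 * (\<Sum>c\<in>UNIV. cub1 C b c X * \<mu> $ c) + \<nu> $ b)"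
    by (simp add: fields solution_dU_def fun_eq_iff)
  show ?thesis
    unfolding dU
  proof (rule has_pd_eqI)
    show "has_pd a (\<lambda>X. 3 * l / 2 * cub2 C b X + 3 * (\<Sum>c\<in>UNIV. cub1 C b c X * \<mu> $ c) + \<nu> $ b)
       (3 * l / 2 * (2 * cub1 C a b X) + 3 * (\<Sum>c\<in>UNIV. C a b c * \<mu> $ c) + 0) X"
      by (intro has_pd_intros has_pd_cub2 has_pd_cub1)
    have "(\<Sum>c\<in>UNIV. C a b c * \<mu> $ c) = cub1 C a b \<mu>"
      by (simp add: cub1_def)
    then show "3 * l / 2 * (2 * cub1 C a b X) + 3 * (\<Sum>c\<in>UNIV. C a b c * \<mu> $ c) + 0
        = 3 * cub1 C a b (solution_T p X)"
      by (simp add: fields cub1_linear)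
  qed
qed

lemma has_pd_affine: "has_pd e (\<lambda>X. l * X $ c + k) (if c = e then l else 0) X"
  by (rule has_pd_eqI[OF has_pd_add[OF has_pd_cmult[OF has_pd_component] has_pd_const]]) simp

lemma affine_imp_compatible:
  assumes "open S" "X \<in> S" and T: "\<And>Y c. Y \<in> S \<Longrightarrow> T Y $ c = l * Y $ c + \<mu> $ c"
  shows "(\<Sum>c\<in>UNIV. C a c b * pd e (\<lambda>X. T X $ c) X - C a c e * pd b (\<lambda>X. T X $ c) X) = 0"
proof -
  have pd: "pd e (\<lambda>X. T X $ c) X = (if c = e then l else 0)" for c e
  proof -
    have "pd e (\<lambda>X. T X $ c) X = pd e (\<lambda>X. l * X $ c + \<mu> $ c) X"
      by (rule pd_cong[OF assms(1,2)]) (rule T)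
    then show ?thesis
      using has_pd_imp_pd[OF has_pd_affine] by metis
  qed
  show ?thesis
    unfolding pd sum_subtractf using sym23[of a b e]
    by (simp add: if_distrib cong: if_cong)
qed

text \<open>
  Scalar centroid makes the Jacobian of \<open>T\<close> a multiple \<open>L\<close> of the identity. All diagonal entries being
  equal, \<open>L\<close> may be read off from any \<open>T\<^sup>c\<close>; to differentiate it along \<open>e\<close> one chooses \<open>c \<noteq> e\<close> and commutes
  the two derivatives.
\<close>

lemma compatible_imp_affine:
  fixes T :: "complex^'i \<Rightarrow> complex^'i"
  assumes cen: "scalar_centroid C" and card: "CARD('i) \<ge> 2"
    and S: "open S" "connected S" "S \<noteq> {}"
    and T: "\<And>c. separately_holomorphic (\<lambda>X. T X $ c) S"
    and eq: "\<And>X a b e. X \<in> S \<Longrightarrow>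
      (\<Sum>c\<in>UNIV. C a c b * pd e (\<lambda>X. T X $ c) X - C a c e * pd b (\<lambda>X. T X $ c) X) = 0"
  shows "\<exists>l \<mu>. \<forall>X\<in>S. \<forall>c. T X $ c = l * X $ c + \<mu> $ c"
proof -
  obtain X0 where X0: "X0 \<in> S" using S by blast
  have other: "\<exists>d. d \<noteq> c" for c :: 'i
    using card_2_iff' card by (metis (full_types) One_nat_def UNIV_I card_1_singleton_iff
        numeral_2_eq_2 Suc_n_not_le_n UNIV_eq_I singletonI)
  define L where "L c = pd c (\<lambda>X. T X $ c)" for c
  have scalar: "pd e (\<lambda>X. T X $ c) X = (if c = e then L d X else 0)" if X: "X \<in> S" for X c d e
  proof -
    have "(\<Sum>c\<in>UNIV. C a c b * pd e (\<lambda>X. T X $ c) X) = (\<Sum>c\<in>UNIV. C a c e * pd b (\<lambda>X. T X $ c) X)"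
      for a b e
      using eq[OF X, of a b e] by (simp add: sum_subtractf)
    then obtain l where l: "\<And>c e. pd e (\<lambda>X. T X $ c) X = (if c = e then l else 0)"
      using cen[unfolded scalar_centroid_def, rule_format, of "\<lambda>c e. pd e (\<lambda>X. T X $ c) X"] by blast
    show ?thesis using l[of d d] l[of e c] by (simp add: L_def)
  qed
  have const: "L c X = L d X0" if X: "X \<in> S" for X c d
  proof -
    have "has_pd e (L d) 0 X" if X: "X \<in> S" for X e
    proof -
      obtain c where c: "c \<noteq> e" using other by blast
      have "has_pd e (L c) (pd e (L c) X) X"
        unfolding L_def by (rule has_pd_pd[OF separately_holomorphic_pd[OF T S(1)] X])
      also have "pd e (L c) X = pd c (pd e (\<lambda>X. T X $ c)) X"
        unfolding L_def by (rule pd_commute[OF T S(1) X])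
      also have "\<dots> = pd c (\<lambda>X. 0) X"
        by (rule pd_cong[OF S(1) X]) (use scalar[of _ e c c] c in auto)
      also have "\<dots> = 0"
        by (rule has_pd_imp_pd[OF has_pd_const])
      finally show ?thesis
        by (rule has_pd_cong[OF _ S(1) X]) (metis scalar L_def)
    qed
    from zero_partials_imp_constant[OF S(1,2) this X X0] have "L d X = L d X0" .
    then show ?thesis using scalar[OF X, of c c d] by (simp add: L_def)
  qed
  \<comment> \<open>Any index will do: by \<open>const\<close> all \<open>L d X0\<close> agree.\<close>
  define l where "l = L undefined X0"
  have "T X $ c - l * X $ c = T X0 $ c - l * X0 $ c" if X: "X \<in> S" for X c
  proof (rule zero_partials_imp_constant[OF S(1,2) _ X X0, where f = "\<lambda>X. T X $ c - l * X $ c"])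
    fix X e assume X: "X \<in> S"
    have "pd e (\<lambda>X. T X $ c) X = (if c = e then l else 0)"
      using scalar[OF X, of e c c] unfolding const[OF X, of c undefined] l_def .
    then have "has_pd e (\<lambda>X. T X $ c) (if c = e then l else 0) X"
      using has_pd_pd[OF T X, of e c] by simp
    from has_pd_diff[OF this has_pd_cmult[OF has_pd_component, where k = l]]
    show "has_pd e (\<lambda>X. T X $ c - l * X $ c) 0 X"
      by (rule has_pd_eqI) simp
  qed
  then have "T X $ c = l * X $ c + (\<chi> c. T X0 $ c - l * X0 $ c) $ c" if "X \<in> S" for X c
    using that by (simp add: algebra_simps)
  then show ?thesis by blast
qed

text \<open>
  Apart from commuting third derivatives of \<open>U\<close>, this is integration: \<open>k1\<close>, \<open>\<nu>\<close> and \<open>k2\<close> appear, in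
  this order, as constants of integration for \<open>Z\<close>, for the gradient of \<open>U\<close>, and for \<open>U\<close>.
\<close>

lemma monge_imp_solution:
  assumes cen: "scalar_centroid C" and card: "CARD('i) \<ge> 2"
    and S: "open S" "connected S" "S \<noteq> {}"
    and Z: "separately_holomorphic Z S" and U: "separately_holomorphic U S"
    and T: "\<And>c. separately_holomorphic (\<lambda>X. T X $ c) S"
    and monge: "monge_equations C S Z U T"
  shows "\<exists>p. \<forall>X\<in>S. T X = solution_T p X \<and> Z X = solution_Z C p X \<and> U X = solution_U C p X"
proof -
  obtain X0 where X0: "X0 \<in> S" using S by blast
  have pdZ: "pd a Z X = 3/2 * cub2 C a (T X)" and pdU: "pd a (pd b U) X = 3 * cub1 C a b (T X)"
    if "X \<in> S" for a b X
    using monge that by (auto simp: monge_equations_def)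
  have dU: "separately_holomorphic (pd b U) S" for b
    by (rule separately_holomorphic_pd[OF U S(1)])
  have pd3: "pd e (pd a (pd b U)) X = 3 * (\<Sum>c\<in>UNIV. C a b c * pd e (\<lambda>X. T X $ c) X)"
    if X: "X \<in> S" for a b e X
  proof -
    have "pd e (pd a (pd b U)) X = pd e (\<lambda>X. 3 * (\<Sum>c\<in>UNIV. C a b c * T X $ c)) X"
      by (rule pd_cong[OF S(1) X]) (simp add: pdU cub1_def)
    also have "\<dots> = 3 * (\<Sum>c\<in>UNIV. C a b c * pd e (\<lambda>X. T X $ c) X)"
      by (rule has_pd_imp_pd) (intro has_pd_intros has_pd_pd[OF T X])
    finally show ?thesis .
  qed
  have "\<exists>l \<mu>. \<forall>X\<in>S. \<forall>c. T X $ c = l * X $ c + \<mu> $ c"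
  proof (rule compatible_imp_affine[OF cen card S T])
    fix X a b e assume X: "X \<in> S"
    have "pd e (pd b (pd a U)) X = pd b (pd e (pd a U)) X"
      by (rule pd_commute[OF dU S(1) X])
    then show "(\<Sum>c\<in>UNIV. C a c b * pd e (\<lambda>X. T X $ c) X - C a c e * pd b (\<lambda>X. T X $ c) X) = 0"
      unfolding pd3[OF X] by (simp add: sum_subtractf sym12[of _ a] sym23[of a])
  qed
  then obtain l \<mu> where Tl: "\<And>X c. X \<in> S \<Longrightarrow> T X $ c = l * X $ c + \<mu> $ c" by blast
  have T_sol: "T X = solution_T (l, \<mu>, \<nu>, k1, k2) X" if "X \<in> S" for X \<nu> k1 k2
    using Tl[OF that] by (simp add: vec_eq_iff)
  define p where "p = (l, \<mu>, (0 :: complex^'i), (0 :: complex), (0 :: complex))"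
  have Tp: "T X = solution_T p X" if "X \<in> S" for X
    unfolding p_def by (rule T_sol[OF that])
  define k1 where "k1 = Z X0 - solution_Z C p X0"
  have Zk: "Z X - solution_Z C p X = k1" if X: "X \<in> S" for X
    unfolding k1_def
  proof (rule zero_partials_imp_constant[OF S(1,2) _ X X0, where f = "\<lambda>X. Z X - solution_Z C p X"])
    fix X a assume X: "X \<in> S"
    show "has_pd a (\<lambda>X. Z X - solution_Z C p X) 0 X"
      by (rule has_pd_eqI[OF has_pd_diff[OF has_pd_pd[OF Z X] has_pd_solution_Z]])
        (simp add: pdZ[OF X] Tp[OF X])
  qed
  define \<nu> where "\<nu> = (\<chi> b. pd b U X0 - solution_dU b p X0)"
  have dUk: "pd b U X - solution_dU b p X = \<nu> $ b" if X: "X \<in> S" for X b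
    unfolding \<nu>_def vec_lambda_beta
  proof (rule zero_partials_imp_constant[OF S(1,2) _ X X0, where f = "\<lambda>X. pd b U X - solution_dU b p X"])
    fix X a assume X: "X \<in> S"
    show "has_pd a (\<lambda>X. pd b U X - solution_dU b p X) 0 X"
      by (rule has_pd_eqI[OF has_pd_diff[OF has_pd_pd[OF dU X] has_pd_solution_dU]])
        (simp add: pdU[OF X] Tp[OF X])
  qed
  define q where "q = (l, \<mu>, \<nu>, k1, (0 :: complex))"
  have q_dU: "solution_dU b q X = solution_dU b p X + \<nu> $ b" for b X
    by (simp add: solution_dU_def p_def q_def)
  define k2 where "k2 = U X0 - solution_U C q X0"
  have Uk: "U X - solution_U C q X = k2" if X: "X \<in> S" for X
    unfolding k2_def
  proof (rule zero_partials_imp_constant[OF S(1,2) _ X X0, where f = "\<lambda>X. U X - solution_U C q X"])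
    fix X a assume X: "X \<in> S"
    show "has_pd a (\<lambda>X. U X - solution_U C q X) 0 X"
      by (rule has_pd_eqI[OF has_pd_diff[OF has_pd_pd[OF U X] has_pd_solution_U]])
        (use dUk[OF X, of a] in \<open>simp add: q_dU algebra_simps\<close>)
  qed
  have "Z X = solution_Z C (l, \<mu>, \<nu>, k1, k2) X" "U X = solution_U C (l, \<mu>, \<nu>, k1, k2) X"
    if "X \<in> S" for X
    using Zk[OF that] Uk[OF that] by (simp_all add: p_def q_def algebra_simps)
  with T_sol show ?thesis by blast
qed

lemma solution_imp_monge:
  assumes S: "open S"
    and sol: "\<And>X. X \<in> S \<Longrightarrow> T X = solution_T p X \<and> Z X = solution_Z C p X \<and> U X = solution_U C p X"
  shows "monge_equations C S Z U T"
  unfolding monge_equations_def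
proof (intro ballI conjI allI)
  fix X a b assume X: "X \<in> S"
  have "pd a Z X = pd a (solution_Z C p) X"
    by (rule pd_cong[OF S X]) (simp add: sol)
  then show "pd a Z X = 3/2 * cub2 C a (T X)"
    using has_pd_imp_pd[OF has_pd_solution_Z] sol[OF X] by metis
  have "pd b U Y = solution_dU b p Y" if "Y \<in> S" for Y
  proof -
    have "pd b U Y = pd b (solution_U C p) Y"
      by (rule pd_cong[OF S that]) (simp add: sol)
    then show ?thesis using has_pd_imp_pd[OF has_pd_solution_U] by metis
  qed
  then have "pd a (pd b U) X = pd a (solution_dU b p) X"
    by (rule pd_cong[OF S X])
  then show "pd a (pd b U) X = 3 * cub1 C a b (T X)"
    using has_pd_imp_pd[OF has_pd_solution_dU] sol[OF X] by metis
qed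

text \<open>
  If \<open>v\<close> is in the radical, the matrix whose only nonzero column is \<open>v\<close> lies in the centroid, because both
  sides of the defining equation vanish. A scalar matrix with a zero column is zero.
\<close>

lemma nondegenerate_if_scalar_centroid:
  assumes cen: "scalar_centroid C" and card: "CARD('i) \<ge> 2"
    and zero: "\<And>a b. cub1 C a b v = 0"
  shows "v = 0"
proof -
  have "\<exists>x y :: 'i. x \<noteq> y"
    using card by (metis (full_types) One_nat_def UNIV_I card_1_singleton_iff
        numeral_2_eq_2 Suc_n_not_le_n UNIV_eq_I singletonI)
  then obtain x y :: 'i where xy: "x \<noteq> y" by blast
  define A where "A c e = (if e = x then v $ c else 0)" for c e
  have "(\<Sum>c\<in>UNIV. C a c b * A c e) = 0" for a b e
    using zero[of a b] by (cases "e = x") (simp_all add: A_def cub1_def sym23[of a b])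
  then obtain l where l: "\<And>c e. A c e = (if c = e then l else 0)"
    using cen[unfolded scalar_centroid_def, rule_format, of A] by auto
  from l[of y y] have "l = 0" using xy by (simp add: A_def)
  then have "v $ c = 0" for c using l[of c x] by (simp add: A_def split: if_splits)
  then show ?thesis by (simp add: vec_eq_iff)
qed

text \<open>
  The constants are recovered by differentiating: \<open>l\<close> from third derivatives of \<open>U\<close>, \<open>\<mu>\<close> from second
  ones by nondegeneracy, \<open>\<nu>\<close> from first ones, and the additive constants from values.
\<close>

lemma solution_unique:
  assumes cen: "scalar_centroid C" and card: "CARD('i) \<ge> 2"
    and S: "open S" "S \<noteq> {}"
    and eq: "\<And>X. X \<in> S \<Longrightarrow> solution_Z C p X = solution_Z C q X \<and> solution_U C p X = solution_U C q X"
  shows "p = q"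
proof -
  obtain l \<mu> \<nu> k1 k2 where p: "p = (l, \<mu>, \<nu>, k1, k2)" by (cases p)
  obtain l' \<mu>' \<nu>' k1' k2' where q: "q = (l', \<mu>', \<nu>', k1', k2')" by (cases q)
  obtain X0 where X0: "X0 \<in> S" using S by blast
  note nondeg = nondegenerate_if_scalar_centroid[OF cen card]
  have dU: "solution_dU b p X = solution_dU b q X" if X: "X \<in> S" for b X
    using pd_cong[OF S(1) X, of "solution_U C p" "solution_U C q" b] eq
      has_pd_imp_pd[OF has_pd_solution_U] by metis
  have ddU: "cub1 C a b (solution_T p X) = cub1 C a b (solution_T q X)" if X: "X \<in> S" for a b X
  proof -
    have "3 * cub1 C a b (solution_T p X) = 3 * cub1 C a b (solution_T q X)"
      using pd_cong[OF S(1) X, of "solution_dU b p" "solution_dU b q" a] dU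
        has_pd_imp_pd[OF has_pd_solution_dU] by metis
    then show ?thesis by simp
  qed
  have "l * C a b e = l' * C a b e" for a b e
  proof -
    have der: "has_pd e (\<lambda>X. cub1 C a b (solution_T (l, \<mu>, \<nu>, k1, k2) X)) (l * C a b e) X"
      for l :: complex and \<mu> \<nu> k1 k2 X
    proof -
      have "has_pd e (\<lambda>X. l * cub1 C a b X + cub1 C a b \<mu>) (l * C e a b + 0) X"
        by (intro has_pd_intros has_pd_cub1)
      moreover have "C e a b = C a b e" by (metis sym12 sym23)
      ultimately show ?thesis by (simp add: cub1_linear)
    qed
    have "pd e (\<lambda>X. cub1 C a b (solution_T p X)) X0 = pd e (\<lambda>X. cub1 C a b (solution_T q X)) X0"
      by (rule pd_cong[OF S(1) X0 ddU])
    then show ?thesis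
      using has_pd_imp_pd[OF der] unfolding p q by metis
  qed
  moreover have "\<exists>a b e. C a b e \<noteq> 0"
    using nondeg[of "axis undefined 1"] by (force simp: cub1_def)
  ultimately have l: "l = l'" by auto
  have "\<mu> - \<mu>' = 0"
  proof (rule nondeg)
    fix a b
    show "cub1 C a b (\<mu> - \<mu>') = 0"
      using ddU[OF X0, of a b] unfolding p q l
      by (simp add: cub1_linear) (simp add: cub1_def algebra_simps sum_subtractf)
  qed
  then have \<mu>: "\<mu> = \<mu>'" by simp
  have "\<nu> $ b = \<nu>' $ b" for b
    using dU[OF X0, of b] by (simp add: p q l \<mu> solution_dU_def)
  then have \<nu>: "\<nu> = \<nu>'" by (simp add: vec_eq_iff)
  show ?thesis
    using eq[OF X0] by (simp add: p q l \<mu> \<nu>)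
qed

end

section \<open>The centroid in coordinates and without them\<close>

text \<open>
  For a cubic form \<open>q\<close> this is six times the symmetric trilinear form whose diagonal is \<open>q\<close>. Defining it
  from \<open>q\<close> alone makes it available for the Jordan algebras, where no components are given.
\<close>

definition polar :: "('v::ab_group_add \<Rightarrow> complex) \<Rightarrow> 'v \<Rightarrow> 'v \<Rightarrow> 'v \<Rightarrow> complex" where
  "polar q x y z = q (x + y + z) - q (x + y) - q (x + z) - q (y + z) + q x + q y + q z"

lemma polar_commute12: "polar q x y z = polar q y x z"
  by (simp add: polar_def add_ac)

lemma polar_commute23: "polar q x y z = polar q x z y"
  by (simp add: polar_def add_ac)

text \<open>
  The centroid on the vector space itself. Any map may be self-adjoint; that it is linear will follow
  from its being scalar.
\<close>

definition self_adjoint_on :: "'v set \<Rightarrow> ('v::ab_group_add \<Rightarrow> complex) \<Rightarrow> ('v \<Rightarrow> 'v) \<Rightarrow> bool" where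
  "self_adjoint_on W q A \<longleftrightarrow> A ` W \<subseteq> W \<and>
     (\<forall>x\<in>W. \<forall>y\<in>W. \<forall>z\<in>W. polar q x (A y) z = polar q x y (A z))"

context cubic_form
begin

definition tri :: "complex^'i \<Rightarrow> complex^'i \<Rightarrow> complex^'i \<Rightarrow> complex" where
  "tri x y z = (\<Sum>a\<in>UNIV. \<Sum>b\<in>UNIV. \<Sum>c\<in>UNIV. C a b c * x $ a * y $ b * z $ c)"

lemma tri_commute12: "tri x y z = tri y x z"
proof -
  have "tri x y z = (\<Sum>b\<in>UNIV. \<Sum>a\<in>UNIV. \<Sum>c\<in>UNIV. C a b c * x $ a * y $ b * z $ c)"
    unfolding tri_def by (rule sum.swap)
  also have "\<dots> = tri y x z"
    unfolding tri_def by (intro sum.cong) (simp_all add: sym12 mult_ac)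
  finally show ?thesis .
qed

lemma tri_commute23: "tri x y z = tri x z y"
proof -
  have "tri x y z = (\<Sum>a\<in>UNIV. \<Sum>c\<in>UNIV. \<Sum>b\<in>UNIV. C a b c * x $ a * y $ b * z $ c)"
    unfolding tri_def by (rule sum.cong[OF refl]) (rule sum.swap)
  also have "\<dots> = tri x z y"
    unfolding tri_def by (intro sum.cong) (simp_all add: sym23 mult_ac)
  finally show ?thesis .
qed

lemma tri_add1: "tri (x + x') y z = tri x y z + tri x' y z"
  by (simp add: tri_def algebra_simps sum.distrib)

lemma tri_add2: "tri x (y + y') z = tri x y z + tri x y' z"
  by (simp add: tri_def algebra_simps sum.distrib)

lemma tri_add3: "tri x y (z + z') = tri x y z + tri x y z'"
  by (simp add: tri_def algebra_simps sum.distrib)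

lemma polar_cub3: "polar (cub3 C) x y z = 6 * tri x y z"
proof -
  have "cub3 C t = tri t t t" for t
    by (simp add: cub3_def tri_def)
  then show ?thesis
    by (simp add: polar_def tri_add1 tri_add2 tri_add3)
      (simp add: tri_commute12 tri_commute23)
qed

text \<open>
  The coordinate condition on \<open>A\<close> is the symmetry of \<open>K\<close> in its last two indices.
\<close>

lemma tri_self_adjoint:
  assumes A: "\<And>a b e. (\<Sum>c\<in>UNIV. C a c b * A c e) = (\<Sum>c\<in>UNIV. C a c e * A c b)"
  shows "tri x ((\<chi> c e. A c e) *v y) z = tri x y ((\<chi> c e. A c e) *v z)"
proof -
  define K where "K a b e = (\<Sum>c\<in>UNIV. C a c b * A c e)" for a b e
  have expand: "tri x ((\<chi> c e. A c e) *v y) z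
      = (\<Sum>a\<in>UNIV. \<Sum>b\<in>UNIV. \<Sum>e\<in>UNIV. K a b e * x $ a * y $ e * z $ b)" for x y z
  proof -
    have "(\<Sum>c\<in>UNIV. \<Sum>b\<in>UNIV. C a c b * x $ a * ((\<chi> c e. A c e) *v y) $ c * z $ b)
      = (\<Sum>b\<in>UNIV. \<Sum>e\<in>UNIV. K a b e * x $ a * y $ e * z $ b)" for a
    proof -
      have "(\<Sum>c\<in>UNIV. \<Sum>b\<in>UNIV. C a c b * x $ a * ((\<chi> c e. A c e) *v y) $ c * z $ b)
        = (\<Sum>c\<in>UNIV. \<Sum>b\<in>UNIV. \<Sum>e\<in>UNIV. C a c b * A c e * x $ a * y $ e * z $ b)"
        by (simp add: matrix_vector_mult_def sum_distrib_left sum_distrib_right mult_ac)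
      also have "\<dots> = (\<Sum>b\<in>UNIV. \<Sum>c\<in>UNIV. \<Sum>e\<in>UNIV. C a c b * A c e * x $ a * y $ e * z $ b)"
        by (rule sum.swap)
      also have "\<dots> = (\<Sum>b\<in>UNIV. \<Sum>e\<in>UNIV. \<Sum>c\<in>UNIV. C a c b * A c e * x $ a * y $ e * z $ b)"
        by (intro sum.cong refl sum.swap)
      also have "\<dots> = (\<Sum>b\<in>UNIV. \<Sum>e\<in>UNIV. K a b e * x $ a * y $ e * z $ b)"
        by (simp add: K_def sum_distrib_right)
      finally show ?thesis .
    qed
    then show ?thesis by (simp add: tri_def)
  qed
  have "(\<Sum>b\<in>UNIV. \<Sum>e\<in>UNIV. K a b e * x $ a * y $ e * z $ b)
      = (\<Sum>b\<in>UNIV. \<Sum>e\<in>UNIV. K a b e * x $ a * z $ e * y $ b)" for a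
    by (subst sum.swap, intro sum.cong refl) (use A in \<open>simp add: K_def mult_ac\<close>)
  then have "tri x ((\<chi> c e. A c e) *v y) z = tri x ((\<chi> c e. A c e) *v z) y"
    by (simp add: expand)
  then show ?thesis
    using tri_commute23[of x y] by simp
qed

end

text \<open>
  The setting of \<open>components_in_basis\<close>: the basis identifies \<open>\<complex>\<^sup>n\<close> with \<open>W\<close> and the component form with
  \<open>q\<close>, so matrices in the centroid become self-adjoint maps of \<open>W\<close>.
\<close>

locale cubic_form_in_basis = vector_space smul
  for smul :: "complex \<Rightarrow> 'v::ab_group_add \<Rightarrow> 'v" +
  fixes W :: "'v set" and q :: "'v \<Rightarrow> complex" and w :: "'i::finite \<Rightarrow> 'v"
    and C :: "'i \<Rightarrow> 'i \<Rightarrow> 'i \<Rightarrow> complex"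
  assumes components: "components_in_basis smul W q w C"
begin

sublocale cubic_form C
  using components unfolding components_in_basis_def by unfold_locales blast+

definition vec_of :: "complex^'i \<Rightarrow> 'v" where
  "vec_of t = (\<Sum>a\<in>UNIV. smul (t $ a) (w a))"

lemma inj_w: "inj w" and independent_w: "independent (range w)" and span_w: "span (range w) = W"
  using components unfolding components_in_basis_def indexed_basis_def by blast+

lemma vec_of_add: "vec_of (t + u) = vec_of t + vec_of u"
  by (simp add: vec_of_def scale_left_distrib sum.distrib)

lemma vec_of_scale: "vec_of (c *s t) = smul c (vec_of t)"
  by (simp add: vec_of_def scale_sum_right)

lemma range_vec_of: "range vec_of = W"
proof -
  have eq: "(\<Sum>v\<in>range w. smul (u v) v) = vec_of (\<chi> a. u (w a))" for u
    by (simp add: vec_of_def sum.reindex[OF inj_w])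
  have onto: "vec_of t = (\<Sum>v\<in>range w. smul (t $ inv w v) v)" for t
    unfolding eq by (simp add: inj_w)
  have "range vec_of = range (\<lambda>u. \<Sum>v\<in>range w. smul (u v) v)"
  proof (intro equalityI image_subsetI)
    show "vec_of t \<in> range (\<lambda>u. \<Sum>v\<in>range w. smul (u v) v)" for t
      unfolding onto by (rule rangeI)
    show "(\<Sum>v\<in>range w. smul (u v) v) \<in> range vec_of" for u
      unfolding eq by (rule rangeI)
  qed
  then show ?thesis
    unfolding span_w[symmetric] by (simp add: span_finite)
qed

lemma inj_vec_of: "inj vec_of"
proof (rule injI)
  fix t u assume eq: "vec_of t = vec_of u"
  have "(\<Sum>v\<in>range w. smul ((t - u) $ inv w v) v) = 0"
    using eq by (simp add: sum.reindex[OF inj_w] inj_w vec_of_def scale_left_diff_distrib sum_subtractf)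
  then have "(t - u) $ inv w (w a) = 0" for a
    using independentD[OF independent_w _ subset_refl, of "\<lambda>v. (t - u) $ inv w v" "w a"] by simp
  then show "t = u"
    by (simp add: inj_w vec_eq_iff)
qed

lemma polar_vec_of: "polar q (vec_of x) (vec_of y) (vec_of z) = 6 * tri x y z"
proof -
  have "q (vec_of t) = cub3 C t" for t
    using components unfolding components_in_basis_def vec_of_def cub3_def by blast
  then have "polar q (vec_of x) (vec_of y) (vec_of z) = polar (cub3 C) x y z"
    by (simp add: polar_def vec_of_add[symmetric])
  then show ?thesis by (simp add: polar_cub3)
qed

lemma scalar_centroid_if_self_adjoint_scalar:
  assumes scalar: "\<And>A. self_adjoint_on W q A \<Longrightarrow> \<exists>l. \<forall>x\<in>W. A x = smul l x"
  shows "scalar_centroid C"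
  unfolding scalar_centroid_def
proof (intro allI impI)
  fix A :: "'i \<Rightarrow> 'i \<Rightarrow> complex"
  assume A: "\<forall>a b e. (\<Sum>c\<in>UNIV. C a c b * A c e) = (\<Sum>c\<in>UNIV. C a c e * A c b)"
  define M where "M = (\<chi> c e. A c e)"
  define B where "B x = vec_of (M *v inv vec_of x)" for x
  have B: "B (vec_of t) = vec_of (M *v t)" for t
    by (simp add: B_def inj_vec_of)
  have "self_adjoint_on W q B"
    unfolding self_adjoint_on_def range_vec_of[symmetric]
    using A by (auto simp: B polar_vec_of M_def tri_self_adjoint)
  then obtain l where l: "\<And>x. x \<in> W \<Longrightarrow> B x = smul l x" using scalar by blast
  have "M *v t = l *s t" for t
  proof -
    have "vec_of t \<in> W" using range_vec_of by blast
    then have "vec_of (M *v t) = vec_of (l *s t)"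
      using l[of "vec_of t"] by (simp only: B vec_of_scale)
    then show ?thesis using inj_vec_of by (simp only: inj_eq)
  qed
  then have "(M *v axis e 1) $ c = (l *s axis e 1) $ c" for c e by simp
  then have "A c e = (if c = e then l else 0)" for c e
    by (simp add: M_def matrix_vector_mult_def axis_def if_distrib cong: if_cong)
  then show "\<exists>l. \<forall>c e. A c e = (if c = e then l else 0)" by blast
qed

text \<open>
  In a one-dimensional space any vector is a multiple of each nonzero one.
\<close>

lemma card_index_ge_2:
  assumes "x \<in> W" "y \<in> W" "x \<noteq> 0" "\<And>c. y \<noteq> smul c x"
  shows "CARD('i) \<ge> 2"
proof (rule ccontr)
  assume "\<not> CARD('i) \<ge> 2"
  then have "CARD('i) = 1"
    using zero_less_card_finite[where 'a = 'i] by linarith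
  then obtain i :: 'i where i: "UNIV = {i}" by (rule card_1_singletonE)
  obtain s t where s: "x = vec_of s" and t: "y = vec_of t"
    using assms(1,2) range_vec_of by blast
  then have "x = smul (s $ i) (w i)" "y = smul (t $ i) (w i)"
    by (simp_all add: vec_of_def i)
  then have "y = smul (t $ i / s $ i) x"
    using \<open>x \<noteq> 0\<close> by (cases "s $ i = 0") auto
  with assms(4) show False by blast
qed

end

section \<open>The complexified octonions\<close>

lemmas coct_defs = coct_mult_def cquat_mult_def ccplx_mult_def cd_mult_def
  coct_conj_def cquat_conj_def ccplx_conj_def cd_conj_def
  coct_scale_def coct_of_def coct_scalar_part_def Let_def

text \<open>
  The complex bilinear extension of the Euclidean inner product, so that \<open>coct_inner x x\<close> is the norm of
  the composition algebra.
\<close>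

definition coct_inner :: "coct \<Rightarrow> coct \<Rightarrow> complex" where
  "coct_inner x y = coct_scalar_part (coct_mult x (coct_conj y))"

lemma coct_inner_components:
  "coct_inner (((x1, x2), (x3, x4)), ((x5, x6), (x7, x8)))
     (((y1, y2), (y3, y4)), ((y5, y6), (y7, y8)))
   = x1 * y1 + x2 * y2 + x3 * y3 + x4 * y4 + x5 * y5 + x6 * y6 + x7 * y7 + x8 * y8"
  by (simp add: coct_inner_def coct_defs algebra_simps)

lemma coct_inner_commute: "coct_inner x y = coct_inner y x"
  by (simp add: coct_inner_def coct_defs algebra_simps)

lemma coct_inner_add_left: "coct_inner (x + y) z = coct_inner x z + coct_inner y z"
  by (simp add: coct_inner_def coct_defs algebra_simps)

lemma coct_inner_add_right: "coct_inner z (x + y) = coct_inner z x + coct_inner z y"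
  by (simp add: coct_inner_def coct_defs algebra_simps)

lemma coct_inner_scale_left: "coct_inner (coct_scale c x) y = c * coct_inner x y"
  by (simp add: coct_inner_def coct_defs algebra_simps)

lemma coct_inner_zero [simp]: "coct_inner 0 x = 0" "coct_inner x 0 = 0"
  by (simp_all add: coct_inner_def coct_defs)

text \<open>
  On each of the four algebras the bilinear form is a sum of squares in the coordinates that the
  algebra uses, and the corresponding unit vectors lie in the algebra. The eight test vectors below
  cover all four cases: those outside the algebra pair with coordinates that vanish there.
\<close>

lemma coct_inner_nondegenerate:
  assumes "x \<in> cdiv_alg A" "y \<in> cdiv_alg A"
    and eq: "\<And>u. u \<in> cdiv_alg A \<Longrightarrow> coct_inner x u = coct_inner y u"
  shows "x = y"
proof -
  obtain x1 x2 x3 x4 x5 x6 x7 x8 where x: "x = (((x1, x2), (x3, x4)), ((x5, x6), (x7, x8)))"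
    by (metis surj_pair)
  obtain y1 y2 y3 y4 y5 y6 y7 y8 where y: "y = (((y1, y2), (y3, y4)), ((y5, y6), (y7, y8)))"
    by (metis surj_pair)
  show ?thesis
    using assms(1,2) eq[of "(((1,0),(0,0)),((0,0),(0,0)))"] eq[of "(((0,1),(0,0)),((0,0),(0,0)))"]
      eq[of "(((0,0),(1,0)),((0,0),(0,0)))"] eq[of "(((0,0),(0,1)),((0,0),(0,0)))"]
      eq[of "(((0,0),(0,0)),((1,0),(0,0)))"] eq[of "(((0,0),(0,0)),((0,1),(0,0)))"]
      eq[of "(((0,0),(0,0)),((0,0),(1,0)))"] eq[of "(((0,0),(0,0)),((0,0),(0,1)))"]
    unfolding x y coct_inner_components
    by (cases A) (auto simp: coct_of_def zero_prod_def image_iff)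
qed

lemma coct_mult_add_left: "coct_mult (x + y) z = coct_mult x z + coct_mult y z"
  by (simp add: coct_defs prod_eq_iff algebra_simps)

lemma coct_mult_add_right: "coct_mult z (x + y) = coct_mult z x + coct_mult z y"
  by (simp add: coct_defs prod_eq_iff algebra_simps)

lemma coct_mult_scale_left: "coct_mult (coct_scale c x) y = coct_scale c (coct_mult x y)"
  by (simp add: coct_defs prod_eq_iff algebra_simps)

lemma coct_mult_scale_right: "coct_mult x (coct_scale c y) = coct_scale c (coct_mult x y)"
  by (simp add: coct_defs prod_eq_iff algebra_simps)

lemma coct_mult_of_left: "coct_mult (coct_of c) x = coct_scale c x"
  by (simp add: coct_defs prod_eq_iff algebra_simps)

lemma coct_mult_of_right: "coct_mult x (coct_of c) = coct_scale c x"
  by (simp add: coct_defs prod_eq_iff algebra_simps)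

interpretation coct: vector_space coct_scale
  by unfold_locales (simp_all add: coct_defs prod_eq_iff algebra_simps)

lemma coct_conj_add: "coct_conj (x + y) = coct_conj x + coct_conj y"
  by (simp add: coct_defs prod_eq_iff)

lemma coct_conj_diff: "coct_conj (x - y) = coct_conj x - coct_conj y"
  by (simp add: coct_defs prod_eq_iff)

lemma coct_conj_scale: "coct_conj (coct_scale c x) = coct_scale c (coct_conj x)"
  by (simp add: coct_defs prod_eq_iff)

lemma coct_conj_conj [simp]: "coct_conj (coct_conj x) = x"
  by (simp add: coct_defs prod_eq_iff)

lemma coct_conj_of [simp]: "coct_conj (coct_of c) = coct_of c"
  by (simp add: coct_defs prod_eq_iff)

lemma coct_of_linear:
  "coct_of a + coct_of b = coct_of (a + b)" "coct_of a - coct_of b = coct_of (a - b)"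
  "coct_scale c (coct_of a) = coct_of (c * a)"
  by (simp_all add: coct_defs prod_eq_iff)

lemma coct_conj_mult: "coct_conj (coct_mult x y) = coct_mult (coct_conj y) (coct_conj x)"
  by (simp add: coct_defs prod_eq_iff algebra_simps)

lemma coct_conj_fixed_iff: "coct_conj x = x \<longleftrightarrow> x = coct_of (coct_scalar_part x)"
  by (auto simp: coct_defs prod_eq_iff)

text \<open>
  Polarizations of \<open>x x\<^sup>* = x\<^sup>* x = |x|\<^sup>2\<close>. This, the next two alternative laws and the cyclicity of
  the trace are the facts about octonions on which the generic cubic equation rests.
\<close>

lemma coct_mult_conj_polarized:
  "coct_mult x (coct_conj y) + coct_mult y (coct_conj x) = coct_of (2 * coct_inner x y)"
  "coct_mult (coct_conj x) y + coct_mult (coct_conj y) x = coct_of (2 * coct_inner x y)"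
  by (simp_all add: coct_inner_def coct_defs prod_eq_iff algebra_simps)

lemma coct_alternative_left: "coct_mult x (coct_mult (coct_conj x) y) = coct_scale (coct_inner x x) y"
  by (simp add: coct_inner_def coct_defs prod_eq_iff algebra_simps)

lemma coct_alternative_right: "coct_mult (coct_mult y (coct_conj x)) x = coct_scale (coct_inner x x) y"
  by (simp add: coct_inner_def coct_defs prod_eq_iff algebra_simps)

text \<open>
  Both sides are scalar parts of triple products, \<open>y (z x)\<close> and \<open>x (y z)\<close>; the real part of an octonionic
  product does not depend on its bracketing, and it is cyclic.
\<close>

lemma coct_trace_cyclic:
  "coct_inner y (coct_conj (coct_mult z x)) = coct_inner x (coct_conj (coct_mult y z))"
  by (simp add: coct_inner_def coct_defs algebra_simps)

section \<open>The determinant of a Hermitian octonionic matrix\<close>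

text \<open>
  The index type \<open>3\<close> is the cyclic group of order three, and \<open>i\<close>, \<open>i + 1\<close>, \<open>i + 2\<close> run through all of
  it. Formulas written with these successors treat the three positions uniformly.
\<close>

lemma index3_distinct [simp]:
  fixes i :: 3
  shows "i + 1 \<noteq> i" "i \<noteq> i + 1" "i + 2 \<noteq> i" "i \<noteq> i + 2" "i + 1 \<noteq> i + 2" "i + 2 \<noteq> i + 1"
  by simp_all

lemma index3_wrap [simp]:
  fixes i :: 3
  shows "i + 1 + 1 = i + 2" "i + 1 + 2 = i" "i + 2 + 1 = i" "i + 2 + 2 = i + 1"
proof -
  have "i + 1 + 2 = i + 3" "i + 2 + 1 = i + 3" "i + 2 + 2 = i + 3 + 1"
    by (simp_all only: add.assoc) simp_all
  then show "i + 1 + 2 = i" "i + 2 + 1 = i" "i + 2 + 2 = i + 1" by simp_all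
qed (simp add: add.assoc)

lemma UNIV_index3: "UNIV = {i, i + 1, i + (2 :: 3)}"
proof -
  have "card {i, i + 1, i + (2 :: 3)} = CARD(3)" by simp
  then show ?thesis by (metis card_subset_eq finite subset_UNIV)
qed

lemma index3_cases:
  fixes i j :: 3
  obtains "j = i" | "j = i + 1" | "j = i + 2"
  using UNIV_index3[of i] by blast

text \<open>Atomic names for the successors of \<open>i\<close>, so that rearranging sums leaves the indices alone.\<close>

lemma index3_successors:
  fixes i :: 3
  obtains j k where "i + 1 = j" "i + 2 = k" "j + 1 = k" "j + 2 = i" "k + 1 = i" "k + 2 = j"
    "j \<noteq> i" "k \<noteq> i" "k \<noteq> j"
  by (rule that[of "i + 1" "i + 2"]) simp_all

lemma sum_index3: "sum f UNIV = f i + f (i + 1) + f (i + (2 :: 3))" for f :: "3 \<Rightarrow> 'a::comm_monoid_add"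
  unfolding UNIV_index3[of i] by (simp add: add.assoc)

text \<open>
  The off-diagonal entry \<open>x i\<close> is placed at the position \<open>(i + 1, i + 2)\<close>, opposite to the diagonal entry
  \<open>a i\<close>. With this numbering all formulas below are invariant under cyclic shifts.
\<close>

definition herm :: "(3 \<Rightarrow> complex) \<Rightarrow> (3 \<Rightarrow> coct) \<Rightarrow> coct^3^3" where
  "herm a x = (\<chi> i j. if j = i then coct_of (a i) else if j = i + 1 then x (i + 2)
                      else coct_conj (x (i + 1)))"

lemma herm_nth [simp]:
  "herm a x $ i $ i = coct_of (a i)" "herm a x $ i $ (i + 1) = x (i + 2)"
  "herm a x $ i $ (i + 2) = coct_conj (x (i + 1))" "herm a x $ (i + 1) $ (i + 2) = x i"
  by (simp_all add: herm_def)

lemma herm_eqI: "(\<And>i. a i = b i) \<Longrightarrow> (\<And>i. x i = y i) \<Longrightarrow> herm a x = herm b y"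
  by (intro arg_cong2[where f = herm] ext)

lemma matrix3_eqI:
  assumes "\<And>i. M $ i $ i = N $ i $ i" "\<And>i. M $ i $ (i + 1) = N $ i $ (i + 1)"
    "\<And>i. M $ i $ (i + 2) = N $ i $ (i + (2 :: 3))"
  shows "M = (N :: 'a^3^3)"
proof -
  have "M $ i $ j = N $ i $ j" for i j
    using assms by (cases j i rule: index3_cases) simp_all
  then show ?thesis by (simp add: vec_eq_iff)
qed

lemma herm_add: "herm a x + herm b y = herm (\<lambda>i. a i + b i) (\<lambda>i. x i + y i)"
  by (rule matrix3_eqI) (simp_all add: coct_conj_add coct_of_linear)

lemma herm_scale: "mat3_scale coct_scale c (herm a x) = herm (\<lambda>i. c * a i) (\<lambda>i. coct_scale c (x i))"
  by (rule matrix3_eqI) (simp_all add: mat3_scale_def coct_conj_scale coct_of_linear)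

lemma herm_diff: "herm a x - herm b y = herm (\<lambda>i. a i - b i) (\<lambda>i. x i - y i)"
  by (rule matrix3_eqI) (simp_all add: coct_conj_diff coct_of_linear)

lemma trace_herm: "hermitian3_trace (herm a x) = a i + a (i + 1) + a (i + 2)"
  unfolding hermitian3_trace_def sum_index3[of _ i]
  by (simp add: coct_scalar_part_def coct_of_def)

lemma hermitian3_iff_herm:
  "M \<in> hermitian3 Octonions \<longleftrightarrow>
     M = herm (\<lambda>i. coct_scalar_part (M $ i $ i)) (\<lambda>i. M $ (i + 1) $ (i + 2))" (is "_ \<longleftrightarrow> M = ?H")
proof
  assume "M \<in> hermitian3 Octonions"
  then have M: "M $ j $ i = coct_conj (M $ i $ j)" for i j
    unfolding hermitian3_def by blast
  show "M = ?H"
  proof (rule matrix3_eqI)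
    fix i
    show "M $ i $ i = ?H $ i $ i"
      using M[of i i] by (simp add: coct_conj_fixed_iff[of "M $ i $ i", symmetric])
    show "M $ i $ (i + 1) = ?H $ i $ (i + 1)" by simp
    show "M $ i $ (i + 2) = ?H $ i $ (i + 2)" using M[of "i + 2" i] by simp
  qed
next
  define H where "H = ?H"
  assume "M = ?H"
  then have M: "M = H" by (simp only: H_def)
  have "H $ j $ i = coct_conj (H $ i $ j)" for i j
    unfolding H_def by (cases j i rule: index3_cases) (simp_all add: herm_def)
  then show "M \<in> hermitian3 Octonions"
    unfolding hermitian3_def M cdiv_alg.simps by blast
qed

text \<open>
  The Jordan product in the coordinates of \<open>herm\<close>. All later computations stay in these coordinates.
\<close>

lemma jordan_mult_herm:
  "jordan_mult (herm a x) (herm b y) =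
     herm (\<lambda>i. a i * b i + coct_inner (x (i + 1)) (y (i + 1)) + coct_inner (x (i + 2)) (y (i + 2)))
       (\<lambda>i. coct_scale (1/2)
          (coct_scale (a (i + 1) + a (i + 2)) (y i) + coct_scale (b (i + 1) + b (i + 2)) (x i)
           + coct_conj (coct_mult (x (i + 1)) (y (i + 2)) + coct_mult (y (i + 1)) (x (i + 2)))))"
  (is "_ = herm ?a ?x")
proof (rule matrix3_eqI)
  fix i :: 3
  obtain j k where ijk: "i + 1 = j" "i + 2 = k" "j + 1 = k" "j + 2 = i" "k + 1 = i" "k + 2 = j"
    "j \<noteq> i" "k \<noteq> i" "k \<noteq> j"
    using index3_successors[of i] .
  have entries: "herm a x $ i $ i = coct_of (a i)" "herm a x $ j $ j = coct_of (a j)"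
    "herm a x $ k $ k = coct_of (a k)" "herm a x $ i $ j = x k" "herm a x $ j $ k = x i"
    "herm a x $ k $ i = x j" "herm a x $ j $ i = coct_conj (x k)"
    "herm a x $ k $ j = coct_conj (x i)" "herm a x $ i $ k = coct_conj (x j)" for a x
    using ijk by (auto simp: herm_def)
  have prod: "coct_matmul M N $ i $ l = coct_mult (M $ i $ i) (N $ i $ l)
      + coct_mult (M $ i $ j) (N $ j $ l) + coct_mult (M $ i $ k) (N $ k $ l)" for M N l
    by (simp add: coct_matmul_def sum_index3[of _ i] ijk)
  have "jordan_mult (herm a x) (herm b y) $ i $ i
     = coct_scale (1/2) (coct_of (a i * b i) + coct_of (b i * a i)
        + (coct_mult (x k) (coct_conj (y k)) + coct_mult (y k) (coct_conj (x k)))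
        + (coct_mult (coct_conj (x j)) (y j) + coct_mult (coct_conj (y j)) (x j)))"
    by (simp add: jordan_mult_def mat3_scale_def prod entries coct_mult_of_left coct_of_linear add_ac)
  also have "\<dots> = coct_of (?a i)"
    unfolding ijk coct_mult_conj_polarized by (simp add: coct_of_linear add_divide_distrib add_ac)
  finally show "jordan_mult (herm a x) (herm b y) $ i $ i = herm ?a ?x $ i $ i"
    by simp
  show "jordan_mult (herm a x) (herm b y) $ i $ (i + 1) = herm ?a ?x $ i $ (i + 1)"
    unfolding ijk entries
    by (simp add: jordan_mult_def mat3_scale_def prod entries coct_mult_of_left coct_mult_of_right
        coct_conj_add coct_conj_mult coct.scale_left_distrib coct.scale_right_distrib add_ac)
  show "jordan_mult (herm a x) (herm b y) $ i $ (i + 2) = herm ?a ?x $ i $ (i + 2)"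
    unfolding ijk entries
    by (simp add: jordan_mult_def mat3_scale_def prod entries coct_mult_of_left coct_mult_of_right
        coct_conj_add coct_conj_scale coct.scale_left_distrib coct.scale_right_distrib add_ac)
qed

lemma jordan_square_herm:
  "jordan_mult (herm a x) (herm a x) =
     herm (\<lambda>i. (a i)\<^sup>2 + coct_inner (x (i + 1)) (x (i + 1)) + coct_inner (x (i + 2)) (x (i + 2)))
       (\<lambda>i. coct_scale (a (i + 1) + a (i + 2)) (x i) + coct_conj (coct_mult (x (i + 1)) (x (i + 2))))"
proof -
  have "coct_scale (1/2) (u + u + coct_conj (v + v)) = u + coct_conj v" for u v
    by (simp add: coct_defs prod_eq_iff)
  then show ?thesis
    unfolding jordan_mult_herm by (simp add: power2_eq_square)
qed

definition herm_det :: "(3 \<Rightarrow> complex) \<Rightarrow> (3 \<Rightarrow> coct) \<Rightarrow> complex" where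
  "herm_det a x = a 0 * a 1 * a 2
     - (a 0 * coct_inner (x 0) (x 0) + a 1 * coct_inner (x 1) (x 1) + a 2 * coct_inner (x 2) (x 2))
     + 2 * coct_inner (x 0) (coct_conj (coct_mult (x 1) (x 2)))"

text \<open>
  The cubic form \<open>a\<^sub>0 a\<^sub>1 a\<^sub>2 - \<Sum> a\<^sub>i |x\<^sub>i|\<^sup>2 + 2 Re (x\<^sub>0 (x\<^sub>1 x\<^sub>2))\<close> may be expanded from any position.
\<close>

lemma herm_det_cyclic:
  assumes "i + 1 = j" "i + 2 = k"
  shows "herm_det a x = a i * a j * a k
     - (a i * coct_inner (x i) (x i) + a j * coct_inner (x j) (x j) + a k * coct_inner (x k) (x k))
     + 2 * coct_inner (x i) (coct_conj (coct_mult (x j) (x k)))"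
proof (cases i "0 :: 3" rule: index3_cases)
  case 1
  then show ?thesis using assms by (simp add: herm_det_def)
next
  case 2
  then have "i = 1" "j = 2" "k = 0" using assms index3_wrap(1,2)[of 0] by simp_all
  then show ?thesis
    by (simp add: herm_det_def coct_trace_cyclic[of "x 1"])
next
  case 3
  then have "i = 2" "j = 0" "k = 1" using assms index3_wrap(3,4)[of 0] by simp_all
  then show ?thesis
    by (simp add: herm_det_def coct_trace_cyclic[of "x 0" "x 1"])
qed

text \<open>
  Let \<open>a2\<close>, \<open>x2\<close> and \<open>a3\<close>, \<open>x3\<close> be the coordinates of the square and of the cube. With
  \<open>p\<^sub>i = (x\<^sub>i\<^sub>+\<^sub>1 x\<^sub>i\<^sub>+\<^sub>2)\<^sup>*\<close>, the alternative laws keep every off-diagonal entry in the span of \<open>x\<^sub>i\<close> and \<open>p\<^sub>i\<close>,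
  and the inner product of \<open>x\<^sub>i\<close> and \<open>p\<^sub>i\<close> does not depend on \<open>i\<close>. The equation becomes one polynomial
  identity on the diagonal and two, the coefficients of \<open>x\<^sub>i\<close> and \<open>p\<^sub>i\<close>, off the diagonal.
\<close>

lemma generic_cubic_equation:
  fixes a x
  defines "M \<equiv> herm a x" and "sc \<equiv> mat3_scale coct_scale"
  defines "M2 \<equiv> jordan_mult M M"
  shows "jordan_mult M M2 - sc (hermitian3_trace M) M2
          - sc (1/2 * (hermitian3_trace M2 - (hermitian3_trace M)\<^sup>2)) M
          - sc (herm_det a x) (\<chi> i j. if i = j then coct_of 1 else 0) = 0"
proof -
  define n where "n i = coct_inner (x i) (x i)" for i
  define p where "p i = coct_conj (coct_mult (x (i + 1)) (x (i + 2)))" for i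
  define s where "s i = a (i + 1) + a (i + 2)" for i
  define a2 where "a2 i = (a i)\<^sup>2 + n (i + 1) + n (i + 2)" for i
  define x2 where "x2 i = coct_scale (s i) (x i) + p i" for i
  define t where "t = hermitian3_trace M"
  define r where "r = 1/2 * (hermitian3_trace M2 - t\<^sup>2)"
  define a3 where "a3 i = a i * a2 i + coct_inner (x (i + 1)) (x2 (i + 1)) + coct_inner (x (i + 2)) (x2 (i + 2))" for i
  define x3 where "x3 i = coct_scale (1/2) (coct_scale (a (i + 1) + a (i + 2)) (x2 i)
      + coct_scale (a2 (i + 1) + a2 (i + 2)) (x i)
      + coct_conj (coct_mult (x (i + 1)) (x2 (i + 2)) + coct_mult (x2 (i + 1)) (x (i + 2))))" for i
  have M2: "M2 = herm a2 x2"
    unfolding M2_def M_def jordan_square_herm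
    by (rule herm_eqI) (simp_all add: a2_def x2_def s_def p_def n_def)
  have M3: "jordan_mult M M2 = herm a3 x3"
    unfolding M2 M_def jordan_mult_herm
    by (rule herm_eqI) (simp_all add: a3_def x3_def)
  have inner_x2: "coct_inner (x i) (x2 i) = s i * n i + coct_inner (x i) (p i)" for i
    by (simp add: x2_def n_def coct_inner_def coct_conj_add coct_conj_scale coct_mult_add_right
        coct_mult_scale_right) (simp add: coct_defs)
  have one: "(\<chi> i j. if i = j then coct_of 1 else 0) = herm (\<lambda>i. 1) (\<lambda>i. 0)"
    by (rule matrix3_eqI) (simp_all add: coct_defs zero_prod_def)
  have zero: "herm (\<lambda>i. 0) (\<lambda>i. 0) = 0"
    by (rule matrix3_eqI) (simp_all add: coct_defs zero_prod_def)
  have "a3 i - t * a2 i - r * a i - herm_det a x * 1 = 0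
      \<and> x3 i - coct_scale t (x2 i) - coct_scale r (x i) - coct_scale (herm_det a x) 0 = 0" for i
  proof -
    obtain j k where ijk: "i + 1 = j" "i + 2 = k" "j + 1 = k" "j + 2 = i" "k + 1 = i" "k + 2 = j"
      using index3_successors[of i] .
    have s: "s i = a j + a k" "s j = a k + a i" "s k = a i + a j"
      and a2: "a2 i = (a i)\<^sup>2 + n j + n k" "a2 j = (a j)\<^sup>2 + n k + n i" "a2 k = (a k)\<^sup>2 + n i + n j"
      and p: "p i = coct_conj (coct_mult (x j) (x k))" "p j = coct_conj (coct_mult (x k) (x i))"
        "p k = coct_conj (coct_mult (x i) (x j))"
      by (simp_all add: s_def a2_def p_def ijk)
    have t: "t = a i + a j + a k"
      using trace_herm[of a x i] by (simp add: t_def M_def ijk)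
    have r: "r = n i + n j + n k - (a i * a j + a i * a k + a j * a k)"
    proof -
      have "hermitian3_trace M2 = a2 i + a2 j + a2 k"
        using trace_herm[of a2 x2 i] by (simp add: M2 ijk)
      then show ?thesis
        unfolding r_def by (simp add: t a2 field_simps power2_eq_square)
    qed
    have inner_xp: "coct_inner (x j) (p j) = coct_inner (x i) (p i)"
      "coct_inner (x k) (p k) = coct_inner (x i) (p i)"
      using coct_trace_cyclic[of "x i" "x j" "x k"] coct_trace_cyclic[of "x j" "x k" "x i"]
      by (simp_all add: p)
    have diagonal: "a3 i - t * a2 i - r * a i - herm_det a x = 0"
      unfolding a3_def ijk inner_x2 inner_xp herm_det_cyclic[OF ijk(1,2)] t r s a2 p(1) n_def[symmetric]
      by (simp add: algebra_simps power2_eq_square)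
    have mult_x2: "coct_conj (coct_mult (x j) (x2 k)) = coct_scale (s k) (p i) + coct_scale (n j) (x i)"
    proof -
      have "coct_mult (x j) (p k) = coct_scale (n j) (coct_conj (x i))"
        unfolding p coct_conj_mult by (simp add: coct_alternative_left n_def)
      then show ?thesis
        by (simp add: x2_def coct_mult_add_right coct_mult_scale_right coct_conj_add coct_conj_scale p(1))
    qed
    have mult_x2': "coct_conj (coct_mult (x2 j) (x k)) = coct_scale (s j) (p i) + coct_scale (n k) (x i)"
    proof -
      have "coct_mult (p j) (x k) = coct_scale (n k) (coct_conj (x i))"
        unfolding p coct_conj_mult by (simp add: coct_alternative_right n_def)
      then show ?thesis
        by (simp add: x2_def coct_mult_add_left coct_mult_scale_left coct_conj_add coct_conj_scale p(1))
    qed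
    have "x3 i - coct_scale t (x2 i) - coct_scale r (x i)
      = coct_scale (1/2 * (s i * s i + a2 j + a2 k + n j + n k) - t * s i - r) (x i)
        + coct_scale (1/2 * (s i + s j + s k) - t) (p i)"
      unfolding x3_def ijk coct_conj_add mult_x2 mult_x2' s(1)[symmetric]
      unfolding x2_def
      by (simp add: coct.scale_right_distrib coct.scale_left_distrib
          coct.scale_left_diff_distrib add_divide_distrib algebra_simps)
    also have "1/2 * (s i + s j + s k) - t = 0"
      unfolding t s by simp
    also have "1/2 * (s i * s i + a2 j + a2 k + n j + n k) - t * s i - r = 0"
      unfolding t r s a2 by (simp add: field_simps power2_eq_square)
    finally have "x3 i - coct_scale t (x2 i) - coct_scale r (x i) = 0" by simp
    with diagonal show ?thesis by simp
  qed
  then show ?thesis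
    unfolding sc_def t_def[symmetric] r_def[symmetric] one M3
    unfolding M2 M_def herm_scale herm_diff zero[symmetric]
    by (intro herm_eqI) blast+
qed

text \<open>
  The generic cubic equation has at most one constant term, since the identity matrix is not zero.
\<close>

lemma hermitian3_det_herm: "hermitian3_det (herm a x) = herm_det a x"
  unfolding hermitian3_det_def Let_def
proof (rule the_equality)
  let ?I = "(\<chi> i j. if i = j then coct_of 1 else 0) :: coct^3^3"
  fix d
  assume d: "jordan_mult (herm a x) (jordan_mult (herm a x) (herm a x))
      - mat3_scale coct_scale (hermitian3_trace (herm a x)) (jordan_mult (herm a x) (herm a x))
      - mat3_scale coct_scale (1/2 * (hermitian3_trace (jordan_mult (herm a x) (herm a x))
          - (hermitian3_trace (herm a x))\<^sup>2)) (herm a x)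
      - mat3_scale coct_scale d ?I = 0"
  with generic_cubic_equation[of a x]
  have "mat3_scale coct_scale d ?I = mat3_scale coct_scale (herm_det a x) ?I"
    by (metis eq_iff_diff_eq_0)
  then have "mat3_scale coct_scale d ?I $ 0 $ 0 = mat3_scale coct_scale (herm_det a x) ?I $ 0 $ 0"
    by simp
  then show "d = herm_det a x"
    by (simp add: mat3_scale_def coct_defs)
qed (rule generic_cubic_equation)

section \<open>The three families of cubic forms have scalar centroid\<close>

text \<open>
  The frame \<open>e\<close> consists of three orthogonal idempotents, \<open>d\<close> gives the diagonal coordinates, \<open>U i\<close> is
  the space of vectors concentrated in the off-diagonal position \<open>i\<close>, and \<open>\<beta> i\<close> is the bilinear form on
  that position. Only the bilinear forms \<open>polar q (e i)\<close> have to be known.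

  Moving \<open>A\<close> across \<open>polar q (e i)\<close> and using \<open>polar q (e i) (e i) = 0\<close> shows that \<open>A (e i)\<close> is in the
  radical of \<open>polar q (e i)\<close>, which kills its coordinates at \<open>d (i + 1)\<close>, \<open>d (i + 2)\<close> and position \<open>i\<close>. The
  other two positions \<open>j\<close> are killed by \<open>polar q (e j)\<close>, since \<open>U j\<close> is in the radical of \<open>polar q (e i)\<close>.
  So \<open>A (e i)\<close> is a multiple of \<open>e i\<close>, and the value at \<open>e 0\<close>, \<open>e 1\<close>, \<open>e 2\<close> shows that the multiples are
  equal. As the forms \<open>polar q (e i)\<close> together separate points, the same scalar works everywhere.
\<close>

lemma self_adjoint_scalar_if_frame:
  fixes smul :: "complex \<Rightarrow> 'v::ab_group_add \<Rightarrow> 'v" and e :: "3 \<Rightarrow> 'v"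
    and d :: "3 \<Rightarrow> 'v \<Rightarrow> complex" and \<beta> :: "3 \<Rightarrow> 'v \<Rightarrow> 'v \<Rightarrow> complex" and U :: "3 \<Rightarrow> 'v set"
  assumes A: "self_adjoint_on W q A"
    and scale_W: "\<And>s x. x \<in> W \<Longrightarrow> smul s x \<in> W"
    and d_scale: "\<And>i s x. d i (smul s x) = s * d i x"
    and \<beta>_scale: "\<And>i s x y. \<beta> i (smul s x) y = s * \<beta> i x y"
    and \<beta>_commute: "\<And>i x y. \<beta> i x y = \<beta> i y x"
    and e_W: "\<And>i. e i \<in> W" and d_e: "\<And>i j. d j (e i) = (if j = i then 1 else 0)"
    and \<beta>_e: "\<And>i j x. \<beta> j (e i) x = 0"
    and U_W: "\<And>i u. u \<in> U i \<Longrightarrow> u \<in> W" and d_U: "\<And>i j u. u \<in> U i \<Longrightarrow> d j u = 0"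
    and \<beta>_U: "\<And>i j u x. u \<in> U i \<Longrightarrow> j \<noteq> i \<Longrightarrow> \<beta> j u x = 0"
    and polar_e: "\<And>i s x y. x \<in> W \<Longrightarrow> y \<in> W \<Longrightarrow> polar q (smul s (e i)) x y
        = s * (d (i + 1) x * d (i + 2) y + d (i + 2) x * d (i + 1) y - \<beta> i x y)"
    and smul_one: "\<And>x. smul 1 x = x"
    and ext: "\<And>x y. x \<in> W \<Longrightarrow> y \<in> W \<Longrightarrow> (\<And>i. d i x = d i y) \<Longrightarrow>
        (\<And>i u. u \<in> U i \<Longrightarrow> \<beta> i x u = \<beta> i y u) \<Longrightarrow> x = y"
  shows "\<exists>l. \<forall>x\<in>W. A x = smul l x"
proof -
  have A_W: "A x \<in> W" if "x \<in> W" for x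
    using A that unfolding self_adjoint_on_def by blast
  have move: "polar q x (A y) z = polar q x y (A z)" if "x \<in> W" "y \<in> W" "z \<in> W" for x y z
    using A that unfolding self_adjoint_on_def by blast
  have P: "polar q (e i) x y = d (i + 1) x * d (i + 2) y + d (i + 2) x * d (i + 1) y - \<beta> i x y"
    if "x \<in> W" "y \<in> W" for i x y
    using polar_e[OF that, of 1 i] by (simp add: smul_one)
  have \<beta>_e': "\<beta> j x (e i) = 0" for i j x
    using \<beta>_e \<beta>_commute by metis
  define l where "l i = d i (A (e i))" for i
  have A_e: "A (e i) = smul (l i) (e i)" for i
  proof -
    let ?w = "A (e i)"
    have w: "?w \<in> W" by (rule A_W[OF e_W])
    have zero: "polar q (e i) x ?w = 0" if "x \<in> W" for x
    proof -
      have "polar q (e i) x ?w = polar q (e i) (A x) (e i)"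
        by (rule move[symmetric]) (use that e_W in auto)
      also have "\<dots> = 0"
        using P[OF A_W[OF that] e_W, of i i] by (simp add: d_e \<beta>_e')
      finally show ?thesis .
    qed
    have d1: "d (i + 2) ?w = 0"
      using zero[OF e_W[of "i + 1"]] P[OF e_W w, of i "i + 1"] by (simp add: d_e \<beta>_e)
    have d2: "d (i + 1) ?w = 0"
      using zero[OF e_W[of "i + 2"]] P[OF e_W w, of i "i + 2"] by (simp add: d_e \<beta>_e)
    have \<beta>0: "\<beta> j ?w u = 0" if u: "u \<in> U j" for j u
    proof (cases "j = i")
      case True
      then show ?thesis
        using zero[OF U_W[OF u]] P[OF U_W[OF u] w, of i] d_U[OF u] \<beta>_commute[of j ?w u] by simp
    next
      case False
      have "polar q (e j) u ?w = polar q (e j) (A u) (e i)"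
        by (rule move[symmetric]) (use U_W[OF u] e_W in auto)
      also have "\<dots> = polar q (e i) (A u) (e j)"
        by (metis polar_commute12 polar_commute23)
      also have "\<dots> = polar q (e i) u (A (e j))"
        by (rule move) (use U_W[OF u] e_W in auto)
      also have "\<dots> = 0"
        using P[OF U_W[OF u] A_W[OF e_W], of i j] d_U[OF u] \<beta>_U[OF u, of i] False by simp
      finally show ?thesis
        using P[OF U_W[OF u] w, of j] d_U[OF u] \<beta>_commute[of j ?w u] by simp
    qed
    show ?thesis
    proof (rule ext[OF w scale_W[OF e_W]])
      show "d j ?w = d j (smul (l i) (e i))" for j
        by (cases j i rule: index3_cases) (simp_all add: d_scale d_e l_def d1 d2)
      show "\<beta> j ?w u = \<beta> j (smul (l i) (e i)) u" if "u \<in> U j" for j u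
        using \<beta>0[OF that] by (simp add: \<beta>_scale \<beta>_e)
    qed
  qed
  have "l (i + 1) = l (i + 2)" for i
  proof -
    have "polar q (e i) (A (e (i + 1))) (e (i + 2)) = polar q (e i) (e (i + 1)) (A (e (i + 2)))"
      by (rule move) (rule e_W)+
    then show ?thesis
      using P[OF A_W[OF e_W] e_W, of i "i + 1" "i + 2"] P[OF e_W A_W[OF e_W], of i "i + 1" "i + 2"]
      by (simp add: A_e d_scale d_e \<beta>_e \<beta>_e')
  qed
  from this[of 0] this[of "0 + 1"] have l_const: "l j = l 0" for j
    unfolding index3_wrap by (cases j "0::3" rule: index3_cases) simp_all
  have A_e': "A (e i) = smul (l 0) (e i)" for i
    using A_e[of i] unfolding l_const[of i] .
  have "A x = smul (l 0) x" if x: "x \<in> W" for x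
  proof (rule ext[OF A_W[OF x] scale_W[OF x]])
    fix i
    have "polar q (e (i + 1)) (A x) (e (i + 2)) = polar q (e (i + 1)) x (A (e (i + 2)))"
      by (rule move) (use x e_W in auto)
    then show "d i (A x) = d i (smul (l 0) x)"
      using P[OF A_W[OF x] e_W, of "i + 1" "i + 2"] P[OF x scale_W[OF e_W], of "i + 1" "l 0" "i + 2"]
        \<beta>_commute[of _ x "smul _ _"]
      by (simp add: A_e' d_scale d_e \<beta>_e' \<beta>_scale \<beta>_e)
  next
    fix i u assume u: "u \<in> U i"
    have "- \<beta> i (A x) u = polar q (e i) (A x) u"
      using P[OF A_W[OF x] U_W[OF u], of i] d_U[OF u] by simp
    also have "\<dots> = polar q u (A x) (e i)"
      by (metis polar_commute12 polar_commute23)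
    also have "\<dots> = polar q u x (A (e i))"
      by (rule move) (use x U_W[OF u] e_W in auto)
    also have "\<dots> = polar q (smul (l 0) (e i)) x u"
      unfolding A_e' by (metis polar_commute12 polar_commute23)
    also have "\<dots> = - (l 0 * \<beta> i x u)"
      using polar_e[OF x U_W[OF u], of "l 0" i] d_U[OF u] by simp
    finally show "\<beta> i (A x) u = \<beta> i (smul (l 0) x) u"
      by (simp add: \<beta>_scale)
  qed
  then show ?thesis by blast
qed

subsection \<open>Diagonal matrices\<close>

lemma vector_space_mat3_scale:
  assumes "vector_space s"
  shows "vector_space (mat3_scale s)"
proof -
  interpret vector_space s by fact
  show ?thesis
    by unfold_locales
      (simp_all add: mat3_scale_def vec_eq_iff scale_right_distrib scale_left_distrib)
qed

lemma vector_space_complex_mult: "vector_space ((*) :: complex \<Rightarrow> complex \<Rightarrow> complex)"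
  by unfold_locales (simp_all add: algebra_simps)

definition diagonal3 :: "(complex^3^3) set" where
  "diagonal3 = {M. \<forall>i j. i \<noteq> j \<longrightarrow> M $ i $ j = 0}"

definition unit_diag :: "3 \<Rightarrow> complex^3^3" where
  "unit_diag k = (\<chi> i j. if i = k \<and> j = k then 1 else 0)"

lemma det_diagonal3: "M \<in> diagonal3 \<Longrightarrow> det M = M $ i $ i * M $ (i + 1) $ (i + 1) * M $ (i + 2) $ (i + 2)"
proof -
  assume "M \<in> diagonal3"
  then have "det M = (\<Prod>i\<in>UNIV. M $ i $ i)"
    unfolding diagonal3_def by (intro det_diagonal) blast
  then show ?thesis
    unfolding UNIV_index3[of i] by (simp add: mult.assoc)
qed

lemma diagonal3_add: "M \<in> diagonal3 \<Longrightarrow> N \<in> diagonal3 \<Longrightarrow> M + N \<in> diagonal3"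
  by (simp add: diagonal3_def)

text \<open>
  Here there are no off-diagonal positions, so \<open>\<beta>\<close> and \<open>U\<close> are trivial.
\<close>

lemma diagonal3_self_adjoint_scalar:
  assumes "self_adjoint_on diagonal3 det A"
  shows "\<exists>l. \<forall>x\<in>diagonal3. A x = mat3_scale (*) l x"
proof (rule self_adjoint_scalar_if_frame[OF assms, where e = unit_diag
      and d = "\<lambda>i M. M $ i $ i" and \<beta> = "\<lambda>i M N. 0" and U = "\<lambda>i. {}"])
  fix i :: 3 and s and x y :: "complex^3^3" assume x: "x \<in> diagonal3" and y: "y \<in> diagonal3"
  obtain j k where ijk: "i + 1 = j" "i + 2 = k" "j \<noteq> i" "k \<noteq> i"
    using index3_successors[of i] .
  define u where "u = mat3_scale (*) s (unit_diag i)"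
  have u: "u \<in> diagonal3" "u $ i $ i = s" "u $ j $ j = 0" "u $ k $ k = 0"
    using ijk by (auto simp: u_def mat3_scale_def unit_diag_def diagonal3_def)
  note det = det_diagonal3[of _ i, unfolded ijk]
  show "polar det (mat3_scale (*) s (unit_diag i)) x y
      = s * (x $ (i + 1) $ (i + 1) * y $ (i + 2) $ (i + 2)
           + x $ (i + 2) $ (i + 2) * y $ (i + 1) $ (i + 1) - 0)"
    unfolding u_def[symmetric] ijk polar_def
    by (simp add: det diagonal3_add u x y algebra_simps)
next
  fix x y :: "complex^3^3" assume x: "x \<in> diagonal3" "y \<in> diagonal3" "\<And>i. x $ i $ i = y $ i $ i"
  have "x $ i $ j = y $ i $ j" for i j
    using x by (cases "i = j") (simp_all add: diagonal3_def)
  then show "x = y"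
    by (simp add: vec_eq_iff)
qed (auto simp: diagonal3_def mat3_scale_def unit_diag_def vec_eq_iff)

lemma J3_diag_scalar_centroid:
  fixes C :: "'i::finite \<Rightarrow> 'i \<Rightarrow> 'i \<Rightarrow> complex"
  assumes "cubic_components J3_diag C"
  shows "cubic_form C \<and> scalar_centroid C \<and> CARD('i) \<ge> 2"
proof -
  obtain w where "components_in_basis (mat3_scale (*)) diagonal3 det w C"
    using assms unfolding cubic_components.simps diagonal3_def[symmetric] by blast
  then interpret cubic_form_in_basis "mat3_scale (*)" diagonal3 det w C
    using vector_space_mat3_scale[OF vector_space_complex_mult]
    by (simp add: cubic_form_in_basis_def cubic_form_in_basis_axioms_def)
  have "CARD('i) \<ge> 2"
  proof (rule card_index_ge_2)
    show "unit_diag 0 \<in> diagonal3" "unit_diag 1 \<in> diagonal3"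
      by (simp_all add: unit_diag_def diagonal3_def)
    have "unit_diag 0 $ 0 $ 0 = 1" "unit_diag 0 $ 1 $ 1 = 0" "unit_diag 1 $ 1 $ 1 = 1"
      by (simp_all add: unit_diag_def)
    then show "unit_diag 0 \<noteq> 0" "\<And>c. unit_diag 1 \<noteq> mat3_scale (*) c (unit_diag 0)"
      by (force simp: mat3_scale_def)+
  qed
  then show ?thesis
    using scalar_centroid_if_self_adjoint_scalar[OF diagonal3_self_adjoint_scalar] cubic_form_axioms
    by blast
qed

subsection \<open>Hermitian matrices\<close>

lemma coct_of_in_cdiv_alg: "coct_of c \<in> cdiv_alg A"
  by (cases A) (auto simp: coct_of_def zero_prod_def image_iff)

lemma coct_conj_in_cdiv_alg: "x \<in> cdiv_alg A \<Longrightarrow> coct_conj x \<in> cdiv_alg A"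
  by (cases A) (auto simp: coct_defs zero_prod_def image_iff)

lemma coct_scale_in_cdiv_alg: "x \<in> cdiv_alg A \<Longrightarrow> coct_scale c x \<in> cdiv_alg A"
  by (cases A) (auto simp: coct_defs zero_prod_def image_iff)

lemma zero_in_cdiv_alg: "0 \<in> cdiv_alg A"
  using coct_of_in_cdiv_alg[of 0 A] by (simp add: coct_of_def zero_prod_def)

lemma hermitian3_eq_herm:
  assumes "M \<in> hermitian3 A"
  shows "M = herm (\<lambda>i. coct_scalar_part (M $ i $ i)) (\<lambda>i. M $ (i + 1) $ (i + 2))"
proof -
  have "M \<in> hermitian3 Octonions"
    using assms unfolding hermitian3_def cdiv_alg.simps by blast
  then show ?thesis by (rule iffD1[OF hermitian3_iff_herm])
qed

lemma herm_in_hermitian3: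
  assumes "\<And>i. x i \<in> cdiv_alg A"
  shows "herm a x \<in> hermitian3 A"
proof -
  have "herm a x \<in> hermitian3 Octonions"
    unfolding hermitian3_iff_herm by (rule herm_eqI) (simp_all add: coct_of_def coct_scalar_part_def)
  moreover have "herm a x $ i $ j \<in> cdiv_alg A" for i j
    using assms coct_of_in_cdiv_alg coct_conj_in_cdiv_alg by (auto simp: herm_def)
  ultimately show ?thesis
    unfolding hermitian3_def by blast
qed

definition unit_herm :: "3 \<Rightarrow> coct^3^3" where
  "unit_herm i = herm (\<lambda>j. if j = i then 1 else 0) (\<lambda>j. 0)"

text \<open>
  Adding a multiple of the idempotent does not change the off-diagonal entries, so the trilinear term
  of the determinant cancels in the polarization.
\<close>

lemma polar_unit_herm:
  "polar hermitian3_det (mat3_scale coct_scale s (unit_herm i)) (herm a x) (herm b y)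
     = s * (a (i + 1) * b (i + 2) + a (i + 2) * b (i + 1) - 2 * coct_inner (x i) (y i))"
proof -
  obtain j k where ijk: "i + 1 = j" "i + 2 = k" "j \<noteq> i" "k \<noteq> i"
    using index3_successors[of i] .
  have u: "mat3_scale coct_scale s (unit_herm i) = herm (\<lambda>j. if j = i then s else 0) (\<lambda>j. 0)"
    unfolding unit_herm_def herm_scale by (rule herm_eqI) simp_all
  note det = herm_det_cyclic[OF ijk(1,2)]
  show ?thesis
    unfolding u polar_def herm_add hermitian3_det_herm det ijk
    using ijk
    by (simp add: coct_inner_add_left coct_inner_add_right coct_inner_commute[of "y i" "x i"]
        algebra_simps)
qed

text \<open>
  The four algebras differ only in the space \<open>cdiv_alg A\<close> allowed off the diagonal, on which the inner
  product is nondegenerate.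
\<close>

lemma hermitian3_self_adjoint_scalar:
  assumes "self_adjoint_on (hermitian3 A) hermitian3_det F"
  shows "\<exists>l. \<forall>x\<in>hermitian3 A. F x = mat3_scale coct_scale l x"
proof (rule self_adjoint_scalar_if_frame[OF assms, where e = unit_herm
      and d = "\<lambda>i M. coct_scalar_part (M $ i $ i)"
      and \<beta> = "\<lambda>i M N. 2 * coct_inner (M $ (i + 1) $ (i + 2)) (N $ (i + 1) $ (i + 2))"
      and U = "\<lambda>i. (\<lambda>u. herm (\<lambda>j. 0) (\<lambda>j. if j = i then u else 0)) ` cdiv_alg A"])
  show "mat3_scale coct_scale s x \<in> hermitian3 A" if "x \<in> hermitian3 A" for s x
    unfolding hermitian3_def
  proof (intro CollectI allI conjI)
    fix i j
    have "x $ i $ j \<in> cdiv_alg A" "x $ j $ i = coct_conj (x $ i $ j)"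
      using that unfolding hermitian3_def by blast+
    then show "mat3_scale coct_scale s x $ i $ j \<in> cdiv_alg A"
      "mat3_scale coct_scale s x $ j $ i = coct_conj (mat3_scale coct_scale s x $ i $ j)"
      by (simp_all add: mat3_scale_def coct_scale_in_cdiv_alg coct_conj_scale)
  qed
  show "coct_scalar_part (mat3_scale coct_scale s x $ i $ i) = s * coct_scalar_part (x $ i $ i)" for s i x
    by (simp add: mat3_scale_def coct_defs)
  show "2 * coct_inner (mat3_scale coct_scale s x $ (i + 1) $ (i + 2)) (y $ (i + 1) $ (i + 2)) =
      s * (2 * coct_inner (x $ (i + 1) $ (i + 2)) (y $ (i + 1) $ (i + 2)))" for i s x y
    by (simp add: mat3_scale_def coct_inner_scale_left)
  show "2 * coct_inner (x $ (i + 1) $ (i + 2)) (y $ (i + 1) $ (i + 2))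
      = 2 * coct_inner (y $ (i + 1) $ (i + 2)) (x $ (i + 1) $ (i + 2))" for i x y
    by (simp add: coct_inner_commute)
  show "unit_herm i \<in> hermitian3 A" for i
    unfolding unit_herm_def by (rule herm_in_hermitian3) (rule zero_in_cdiv_alg)
  show "mat3_scale coct_scale 1 x = x" for x
    by (simp add: mat3_scale_def)
  show "polar hermitian3_det (mat3_scale coct_scale s (unit_herm i)) x y =
      s * (coct_scalar_part (x $ (i + 1) $ (i + 1)) * coct_scalar_part (y $ (i + 2) $ (i + 2))
        + coct_scalar_part (x $ (i + 2) $ (i + 2)) * coct_scalar_part (y $ (i + 1) $ (i + 1))
        - 2 * coct_inner (x $ (i + 1) $ (i + 2)) (y $ (i + 1) $ (i + 2)))"
    if "x \<in> hermitian3 A" "y \<in> hermitian3 A" for i s x y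
    using polar_unit_herm[of s i "\<lambda>i. coct_scalar_part (x $ i $ i)" "\<lambda>i. x $ (i + 1) $ (i + 2)"
        "\<lambda>i. coct_scalar_part (y $ i $ i)" "\<lambda>i. y $ (i + 1) $ (i + 2)"]
    unfolding hermitian3_eq_herm[OF that(1), symmetric] hermitian3_eq_herm[OF that(2), symmetric] .
  show "x = y" if xy: "x \<in> hermitian3 A" "y \<in> hermitian3 A"
    and d: "\<And>i. coct_scalar_part (x $ i $ i) = coct_scalar_part (y $ i $ i)"
    and \<beta>: "\<And>i u. u \<in> (\<lambda>u. herm (\<lambda>j. 0) (\<lambda>j. if j = i then u else 0)) ` cdiv_alg A \<Longrightarrow>
      2 * coct_inner (x $ (i + 1) $ (i + 2)) (u $ (i + 1) $ (i + 2)) =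
      2 * coct_inner (y $ (i + 1) $ (i + 2)) (u $ (i + 1) $ (i + 2))" for x y
  proof -
    have "x $ (i + 1) $ (i + 2) = y $ (i + 1) $ (i + 2)" for i
    proof (rule coct_inner_nondegenerate)
      show "x $ (i + 1) $ (i + 2) \<in> cdiv_alg A" "y $ (i + 1) $ (i + 2) \<in> cdiv_alg A"
        using xy unfolding hermitian3_def by blast+
      show "coct_inner (x $ (i + 1) $ (i + 2)) u = coct_inner (y $ (i + 1) $ (i + 2)) u"
        if "u \<in> cdiv_alg A" for u
        using \<beta>[OF imageI[OF that], of i] by simp
    qed
    with d show ?thesis
      by (subst hermitian3_eq_herm[OF xy(1)], subst hermitian3_eq_herm[OF xy(2)]) (simp cong: herm_eqI)
  qed
qed (auto simp: unit_herm_def coct_scalar_part_def coct_of_def intro!: herm_in_hermitian3 zero_in_cdiv_alg)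

lemma J3_scalar_centroid:
  fixes C :: "'i::finite \<Rightarrow> 'i \<Rightarrow> 'i \<Rightarrow> complex"
  assumes "cubic_components (J3 A) C"
  shows "cubic_form C \<and> scalar_centroid C \<and> CARD('i) \<ge> 2"
proof -
  obtain w where "components_in_basis (mat3_scale coct_scale) (hermitian3 A) hermitian3_det w C"
    using assms unfolding cubic_components.simps by blast
  then interpret cubic_form_in_basis "mat3_scale coct_scale" "hermitian3 A" hermitian3_det w C
    using vector_space_mat3_scale[OF coct.vector_space_axioms]
    by (simp add: cubic_form_in_basis_def cubic_form_in_basis_axioms_def)
  have "CARD('i) \<ge> 2"
  proof (rule card_index_ge_2)
    show "unit_herm 0 \<in> hermitian3 A" "unit_herm 1 \<in> hermitian3 A"
      unfolding unit_herm_def by (rule herm_in_hermitian3, rule zero_in_cdiv_alg)+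
    have entries: "unit_herm 0 $ 0 $ 0 = coct_of 1" "unit_herm 0 $ 1 $ 1 = coct_of 0"
      "unit_herm 1 $ 1 $ 1 = coct_of 1"
      by (simp_all add: unit_herm_def)
    show "unit_herm 0 \<noteq> 0"
      using entries(1) by (auto simp: coct_of_def zero_prod_def)
    show "unit_herm 1 \<noteq> mat3_scale coct_scale c (unit_herm 0)" for c
    proof
      assume "unit_herm 1 = mat3_scale coct_scale c (unit_herm 0)"
      then have "unit_herm 1 $ 1 $ 1 = mat3_scale coct_scale c (unit_herm 0) $ 1 $ 1" by simp
      then show False
        by (simp add: entries mat3_scale_def) (simp add: coct_defs)
    qed
  qed
  then show ?thesis
    using scalar_centroid_if_self_adjoint_scalar[OF hermitian3_self_adjoint_scalar] cubic_form_axioms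
    by blast
qed

subsection \<open>Spin factors\<close>

definition spin_scale :: "complex \<Rightarrow> (nat \<Rightarrow> complex) \<times> complex \<Rightarrow> (nat \<Rightarrow> complex) \<times> complex" where
  "spin_scale = (\<lambda>c (v, s). (seq_scale c v, c * s))"

lemma vector_space_spin_scale: "vector_space spin_scale"
  by unfold_locales
    (simp_all add: spin_scale_def seq_scale_def split_beta prod_eq_iff fun_eq_iff algebra_simps)

lemma cspace_closed: "v \<in> cspace m \<Longrightarrow> w \<in> cspace m \<Longrightarrow> v + w \<in> cspace m"
    "v \<in> cspace m \<Longrightarrow> seq_scale c v \<in> cspace m" "0 \<in> cspace m"
  by (simp_all add: cspace_def seq_scale_def)

locale spin_form =
  fixes m :: nat and B :: "(nat \<Rightarrow> complex) \<Rightarrow> (nat \<Rightarrow> complex) \<Rightarrow> complex"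
  assumes form: "nondegenerate_symmetric_form m B" and m: "m \<ge> 2"
begin

lemma B_add: "u \<in> cspace m \<Longrightarrow> v \<in> cspace m \<Longrightarrow> w \<in> cspace m \<Longrightarrow> B (u + v) w = B u w + B v w"
  using form[unfolded nondegenerate_symmetric_form_def, THEN conjunct1] by blast

lemma B_scale: "v \<in> cspace m \<Longrightarrow> w \<in> cspace m \<Longrightarrow> B (seq_scale c v) w = c * B v w"
  using form[unfolded nondegenerate_symmetric_form_def, THEN conjunct2, THEN conjunct1] by blast

lemma B_commute: "v \<in> cspace m \<Longrightarrow> w \<in> cspace m \<Longrightarrow> B v w = B w v"
  using form[unfolded nondegenerate_symmetric_form_def, THEN conjunct2, THEN conjunct2, THEN conjunct1]
  by blast

lemma B_nondegenerate: "v \<in> cspace m \<Longrightarrow> (\<And>w. w \<in> cspace m \<Longrightarrow> B v w = 0) \<Longrightarrow> v = 0"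
  using form[unfolded nondegenerate_symmetric_form_def, THEN conjunct2, THEN conjunct2, THEN conjunct2]
  by blast

lemma B_add_right: "u \<in> cspace m \<Longrightarrow> v \<in> cspace m \<Longrightarrow> w \<in> cspace m \<Longrightarrow> B w (u + v) = B w u + B w v"
  using B_add[of u v w] B_commute[of w "u + v"] B_commute[of w u] B_commute[of w v] cspace_closed(1)
  by simp

lemma B_scale_right: "v \<in> cspace m \<Longrightarrow> w \<in> cspace m \<Longrightarrow> B v (seq_scale c w) = c * B v w"
  using B_scale[of w v c] B_commute[of v "seq_scale c w"] B_commute[of v w] cspace_closed(2) by simp

lemma B_zero: "v \<in> cspace m \<Longrightarrow> B 0 v = 0" "v \<in> cspace m \<Longrightarrow> B v 0 = 0"
proof -
  have z: "seq_scale 0 0 = 0" by (simp add: seq_scale_def fun_eq_iff)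
  show "v \<in> cspace m \<Longrightarrow> B 0 v = 0" using B_scale[of 0 v 0] cspace_closed(3) by (simp add: z)
  then show "v \<in> cspace m \<Longrightarrow> B v 0 = 0" using B_commute[of v 0] cspace_closed(3) by simp
qed

text \<open>
  Vectors of \<open>cspace m\<close> are separated by \<open>B\<close>. The difference is formed with \<open>seq_scale (- 1)\<close>, since
  linearity of \<open>B\<close> is given only for \<open>+\<close> and \<open>seq_scale\<close>.
\<close>

lemma B_eqI:
  assumes "v \<in> cspace m" "v' \<in> cspace m" "\<And>w. w \<in> cspace m \<Longrightarrow> B w v = B w v'"
  shows "v = v'"
proof -
  have neg: "seq_scale (- 1) v' \<in> cspace m" by (rule cspace_closed(2)[OF assms(2)])
  have "v + seq_scale (- 1) v' = 0"
  proof (rule B_nondegenerate[OF cspace_closed(1)[OF assms(1) neg]])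
    fix w assume w: "w \<in> cspace m"
    show "B (v + seq_scale (- 1) v') w = 0"
      using B_add[OF assms(1) neg w] B_scale[OF assms(2) w, of "- 1"] assms(3)[OF w]
        B_commute[OF w assms(1)] B_commute[OF w assms(2)] by simp
  qed
  then show ?thesis
    by (simp add: seq_scale_def fun_eq_iff add_eq_0_iff)
qed

definition spin_cubic :: "(nat \<Rightarrow> complex) \<times> complex \<Rightarrow> complex" where
  "spin_cubic = (\<lambda>(v, s). B v v * s)"

lemma polar_spin_cubic:
  assumes "u \<in> cspace m" "v \<in> cspace m" "w \<in> cspace m"
  shows "polar spin_cubic (u, r) (v, s) (w, t) = 2 * (B u v * t + B u w * s + B v w * r)"
  using assms
  by (simp add: polar_def spin_cubic_def B_add B_add_right cspace_closed B_commute[of v u]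
      B_commute[of w u] B_commute[of w v] algebra_simps)

text \<open>
  Write \<open>A x = (p x, q x)\<close>. Self-adjointness gives \<open>B u w * q (v, 0) = B u v * q (w, 0)\<close> for all \<open>u\<close>, hence
  \<open>q (v, 0) w = q (w, 0) v\<close>. If \<open>q (v, 0)\<close> were not zero, every \<open>w\<close> would be a multiple of \<open>v\<close>, which is
  impossible for \<open>m \<ge> 2\<close>; for \<open>m = 1\<close> it is possible, and the centroid is indeed larger. The other
  coordinates of \<open>A\<close> follow by inserting \<open>(0, 1)\<close>.
\<close>

lemma spin_self_adjoint_scalar:
  assumes A: "self_adjoint_on (cspace m \<times> UNIV) spin_cubic A"
  shows "\<exists>l. \<forall>x\<in>cspace m \<times> UNIV. A x = spin_scale l x"
proof -
  define p where "p x = fst (A x)" for x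
  define q where "q x = snd (A x)" for x
  have A_eq: "A x = (p x, q x)" for x by (simp add: p_def q_def)
  have p: "p (v, s) \<in> cspace m" if "v \<in> cspace m" for v s
  proof -
    have "A (v, s) \<in> cspace m \<times> UNIV" using A that unfolding self_adjoint_on_def by blast
    then show ?thesis by (simp add: A_eq)
  qed
  have move: "B u (p (v, s)) * t + B u w * q (v, s) + B (p (v, s)) w * r
      = B u v * q (w, t) + B u (p (w, t)) * s + B v (p (w, t)) * r"
    if "u \<in> cspace m" "v \<in> cspace m" "w \<in> cspace m" for u v w r s t
  proof -
    have "polar spin_cubic (u, r) (A (v, s)) (w, t) = polar spin_cubic (u, r) (v, s) (A (w, t))"
      using A that unfolding self_adjoint_on_def by blast
    then show ?thesis
      unfolding A_eq polar_spin_cubic[OF that(1) p[OF that(2)] that(3)]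
        polar_spin_cubic[OF that(1,2) p[OF that(3)]]
      by (simp del: distrib_left_numeral)
  qed
  have zero: "(0 :: nat \<Rightarrow> complex) \<in> cspace m" by (rule cspace_closed)
  define l where "l = q (0, 1)"
  have p0: "p (0, 1) = 0"
  proof (rule B_eqI[OF p[OF zero] zero])
    fix w assume w: "w \<in> cspace m"
    show "B w (p (0, 1)) = B w 0"
      using move[OF zero w zero, of 0 1 1] w p[OF zero] p[OF w]
      by (simp add: B_zero zero)
  qed
  have q0: "q (v, 0) = 0" if v: "v \<in> cspace m" for v
  proof (rule ccontr)
    assume nz: "q (v, 0) \<noteq> 0"
    have proportional: "seq_scale (q (v, 0)) u = seq_scale (q (u, 0)) v" if u: "u \<in> cspace m" for u
    proof (rule B_eqI[OF cspace_closed(2)[OF u] cspace_closed(2)[OF v]])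
      fix w assume w: "w \<in> cspace m"
      show "B w (seq_scale (q (v, 0)) u) = B w (seq_scale (q (u, 0)) v)"
        using move[OF w v u, of 0 0 0] by (simp add: B_scale_right w u v mult.commute)
    qed
    define \<delta> where "\<delta> k = (\<lambda>i. if i = k then 1 else 0 :: complex)" for k :: nat
    have "\<delta> 0 \<in> cspace m" "\<delta> 1 \<in> cspace m" using m by (auto simp: \<delta>_def cspace_def)
    then have "q (v, 0) * \<delta> k i = q (\<delta> k, 0) * v i" if "k \<in> {0, 1}" for k i
      using proportional[of "\<delta> k"] that by (auto simp: seq_scale_def fun_eq_iff)
    from this[of 0 0] this[of 0 1] this[of 1 1] nz show False
      by (simp add: \<delta>_def)
  qed
  have "A (v, s) = spin_scale l (v, s)" if v: "v \<in> cspace m" for v s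
  proof -
    have pv: "p (v, s) = seq_scale l v" if v: "v \<in> cspace m" for v s
    proof (rule B_eqI[OF p[OF v] cspace_closed(2)[OF v]])
      fix w assume w: "w \<in> cspace m"
      show "B w (p (v, s)) = B w (seq_scale l v)"
        using move[OF w v zero, of s 1 0] w v p[OF v]
        by (simp add: p0 B_zero l_def[symmetric] B_scale_right mult.commute)
    qed
    obtain u w where uw: "u \<in> cspace m" "w \<in> cspace m" "B u w \<noteq> 0"
    proof -
      have "(\<lambda>i. if i = 0 then 1 else 0 :: complex) \<in> cspace m" using m by (auto simp: cspace_def)
      moreover have "(\<lambda>i. if i = 0 then 1 else 0 :: complex) \<noteq> 0" by (auto simp: fun_eq_iff)
      ultimately show ?thesis using B_nondegenerate that by blast
    qed
    have "B u w * q (v, s) = B u w * (l * s)"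
      using move[OF uw(1) v uw(2), of s 0 0] uw v p[OF uw(2)]
      by (simp add: q0 pv B_scale_right)
    then have "q (v, s) = l * s" using uw(3) by simp
    with pv[OF v] show ?thesis by (simp add: A_eq spin_scale_def)
  qed
  then show ?thesis by blast
qed

end

lemma JS_scalar_centroid:
  fixes C :: "'i::finite \<Rightarrow> 'i \<Rightarrow> 'i \<Rightarrow> complex"
  assumes "cubic_components (JS m) C" "m \<ge> 2"
  shows "cubic_form C \<and> scalar_centroid C \<and> CARD('i) \<ge> 2"
proof -
  obtain B w where form: "nondegenerate_symmetric_form m B"
    and comp: "components_in_basis spin_scale (cspace m \<times> UNIV) (\<lambda>(v, s). B v v * s) w C"
    using assms(1) unfolding cubic_components.simps spin_scale_def by blast
  interpret spin_form m B
    using form assms(2) by unfold_locales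
  interpret cubic_form_in_basis spin_scale "cspace m \<times> UNIV" spin_cubic w C
    using comp vector_space_spin_scale
    by (simp add: cubic_form_in_basis_def cubic_form_in_basis_axioms_def spin_cubic_def)
  have "CARD('i) \<ge> 2"
  proof (rule card_index_ge_2)
    let ?\<delta> = "\<lambda>i. if i = 0 then 1 else 0 :: complex"
    show "(0, 1) \<in> cspace m \<times> UNIV" "(?\<delta>, 0) \<in> cspace m \<times> (UNIV :: complex set)"
      using m by (auto simp: cspace_def)
    show "(0, 1) \<noteq> (0 :: (nat \<Rightarrow> complex) \<times> complex)"
      by (simp add: zero_prod_def)
    show "(?\<delta>, 0) \<noteq> spin_scale c (0, 1)" for c
      by (auto simp: spin_scale_def seq_scale_def fun_eq_iff)
  qed
  then show ?thesis
    using scalar_centroid_if_self_adjoint_scalar[OF spin_self_adjoint_scalar] cubic_form_axioms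
    by blast
qed

text \<open>
  Type \<open>B\<close> yields the odd \<open>m\<close>, where excluding \<open>JS 1\<close> leaves \<open>m \<ge> 3\<close>; type \<open>D\<close> yields the even \<open>m \<ge> 4\<close>.
\<close>

lemma associated_jordan_scalar_centroid:
  fixes C :: "'i::finite \<Rightarrow> 'i \<Rightarrow> 'i \<Rightarrow> complex"
  assumes "associated_jordan G J" "cubic_components J C" "J \<noteq> J3_empty" "J \<noteq> JS 1"
  shows "cubic_form C \<and> scalar_centroid C \<and> CARD('i) \<ge> 2"
  using assms(1)
proof cases
  case (1 l)
  with assms(4) have "2 * l - 5 \<noteq> 1" by blast
  with 1 have "2 * l - 5 \<ge> 2" by presburger
  with 1 assms(2) show ?thesis by (intro JS_scalar_centroid[of "2 * l - 5"]) blast+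
next
  case (2 l)
  then have "2 * l - 6 \<ge> 2" by presburger
  with 2 assms(2) show ?thesis by (intro JS_scalar_centroid[of "2 * l - 6"]) blast+
qed (use assms J3_scalar_centroid J3_diag_scalar_centroid in blast)+

section \<open>The dimension of the space of constants\<close>

text \<open>
  The constants are the coordinates of a vector indexed by two copies of \<open>'i\<close> and three more indices.
\<close>

lemma dim_constants:
  "vector_space.dim constants_scale (UNIV :: 'i::finite constants set) = 2 * CARD('i) + 3"
proof -
  define f :: "complex^('i + 'i + 3) \<Rightarrow> 'i constants" where
    "f t = (t $ Inr (Inr 0), (\<chi> a. t $ Inl a), (\<chi> a. t $ Inr (Inl a)), t $ Inr (Inr 1), t $ Inr (Inr 2))" for t
  interpret c: vector_space "constants_scale :: complex \<Rightarrow> 'i constants \<Rightarrow> _"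
    by unfold_locales (auto simp: vec_eq_iff algebra_simps)
  interpret pair: finite_dimensional_vector_space_pair_1 "(*s)" cart_basis "constants_scale :: complex \<Rightarrow> 'i constants \<Rightarrow> _" ..
  have lin: "Vector_Spaces.linear (*s) constants_scale f"
    by unfold_locales (simp_all add: f_def vec_eq_iff)
  have "inj f"
  proof (rule injI)
    fix t u assume eq: "f t = f u"
    have "t $ x = u $ x" for x
    proof (cases x)
      case (Inl a)
      then show ?thesis using eq by (auto simp: f_def vec_eq_iff)
    next
      case (Inr y)
      show ?thesis
      proof (cases y)
        case (Inl a)
        then show ?thesis using Inr eq by (auto simp: f_def vec_eq_iff)
      next
        case y: (Inr k)
        then show ?thesis using Inr eq
          by (cases k "0::3" rule: index3_cases) (auto simp: f_def)
      qed
    qed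
    then show "t = u" by (simp add: vec_eq_iff)
  qed
  moreover have "surj f"
  proof (rule surjI)
    show "f (\<chi> x. case x of Inl a \<Rightarrow> fst (snd p) $ a
        | Inr (Inl a) \<Rightarrow> fst (snd (snd p)) $ a
        | Inr (Inr k) \<Rightarrow> if k = 0 then fst p else if k = 1 then fst (snd (snd (snd p)))
            else snd (snd (snd (snd p)))) = p" for p
      by (cases p) (simp add: f_def vec_eq_iff)
  qed
  ultimately have "c.dim UNIV = vec.dim (UNIV :: (complex^('i + 'i + 3)) set)"
    using pair.dim_image_eq[OF lin, of UNIV] by simp
  then show ?thesis unfolding vec_dim_card by simp
qed

section \<open>The solutions of the Monge equations\<close>

theorem proposition3p14:
  fixes G :: lie_type and J :: jordan_alg and n :: nat
    and C :: "'i::finite \<Rightarrow> 'i \<Rightarrow> 'i \<Rightarrow> complex"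
    and S :: "(complex^'i) set"
  assumes "associated_jordan G J"
    and "cubic_components J C"
    and "n = 1 + CARD('i)"
    and "J \<noteq> J3_empty" and "J \<noteq> JS 1"
    and "open S" and "connected S" and "S \<noteq> {}"
  shows
    "(\<forall>T :: complex^'i \<Rightarrow> complex^'i.
        (\<forall>c. holomorphic_cn (\<lambda>X. T X $ c) S) \<longrightarrow>
        ((\<forall>X\<in>S. \<forall>a b e. (\<Sum>c\<in>UNIV. C a c b * pd e (\<lambda>X. T X $ c) X
                               - C a c e * pd b (\<lambda>X. T X $ c) X) = 0)
         \<longleftrightarrow> (\<exists>l \<mu>. \<forall>X\<in>S. \<forall>c. T X $ c = l * X $ c + \<mu> $ c)))
     \<and> (\<forall>Z U T. holomorphic_cn Z S \<longrightarrow> holomorphic_cn U S \<longrightarrow>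
          (\<forall>c. holomorphic_cn (\<lambda>X. T X $ c) S) \<longrightarrow>
          (monge_equations C S Z U T \<longleftrightarrow>
            (\<exists>p. \<forall>X\<in>S. T X = solution_T p X \<and> Z X = solution_Z C p X \<and> U X = solution_U C p X)))
     \<and> (\<forall>p q. (\<forall>X\<in>S. solution_Z C p X = solution_Z C q X \<and> solution_U C p X = solution_U C q X)
          \<longrightarrow> p = q)
     \<and> vector_space.dim constants_scale (UNIV :: 'i constants set) = 2 * n + 1"
proof -
  have form: "cubic_form C" and cen: "scalar_centroid C" and card: "CARD('i) \<ge> 2"
    using associated_jordan_scalar_centroid[OF assms(1,2,4,5)] by auto
  interpret cubic_form C by (rule form)
  note S = assms(6-8)
  show ?thesis
  proof (intro conjI allI impI)
    fix T :: "complex^'i \<Rightarrow> complex^'i"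
    assume T: "\<forall>c. holomorphic_cn (\<lambda>X. T X $ c) S"
    show "(\<forall>X\<in>S. \<forall>a b e. (\<Sum>c\<in>UNIV. C a c b * pd e (\<lambda>X. T X $ c) X
                               - C a c e * pd b (\<lambda>X. T X $ c) X) = 0)
         \<longleftrightarrow> (\<exists>l \<mu>. \<forall>X\<in>S. \<forall>c. T X $ c = l * X $ c + \<mu> $ c)" (is "?compatible \<longleftrightarrow> ?affine")
    proof
      assume ?compatible
      then show ?affine
        using compatible_imp_affine[OF cen card S] holomorphic_cn_imp_separately_holomorphic T by blast
    next
      assume ?affine
      then show ?compatible
        using affine_imp_compatible[OF S(1)] by blast
    qed
  next
    fix Z U :: "complex^'i \<Rightarrow> complex" and T :: "complex^'i \<Rightarrow> complex^'i"
    assume hol: "holomorphic_cn Z S" "holomorphic_cn U S" "\<forall>c. holomorphic_cn (\<lambda>X. T X $ c) S"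
    note sep = holomorphic_cn_imp_separately_holomorphic[OF hol(1)]
      holomorphic_cn_imp_separately_holomorphic[OF hol(2)]
      holomorphic_cn_imp_separately_holomorphic[OF spec[OF hol(3)]]
    show "monge_equations C S Z U T \<longleftrightarrow>
      (\<exists>p. \<forall>X\<in>S. T X = solution_T p X \<and> Z X = solution_Z C p X \<and> U X = solution_U C p X)"
      using monge_imp_solution[OF cen card S sep] solution_imp_monge[OF S(1)] by blast
  next
    fix p q :: "'i constants"
    assume "\<forall>X\<in>S. solution_Z C p X = solution_Z C q X \<and> solution_U C p X = solution_U C q X"
    then show "p = q" using solution_unique[OF cen card S(1,3)] by blast
  next
    show "vector_space.dim constants_scale (UNIV :: 'i constants set) = 2 * n + 1"
      using dim_constants[where 'i = 'i] assms(3) by simp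
  qed
qed

end
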